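(* Let $1<\alpha<\beta$, let $\phi,\psi,\theta\in\mathbb{R}$, and let $\Lambda_B$ be the spectrum of the selfadjoint restriction $P_B$, on $[0,1]\cup[\alpha,\beta]$, corresponding to the matrix $B=B(w,\phi,\psi,\theta)$. If $w=0$, then $P_B$ is spectral if and only if $$\frac{\beta}{1+\beta-\alpha}\in\mathbb{N}$$ and the parameters $\psi,\theta$ satisfy $$-\psi+\frac{\left(\theta-\frac12\right)(1-\alpha)}{1+\beta-\alpha}\in\mathbb{Z}.$$ In the affirmative case the spectrum is $\Lambda_B=\frac{\frac12-\theta}{1+\beta-\alpha}+\frac{1}{1+\beta-\alpha}\mathbb{Z}$.
   Context: $e(x):=e^{i2\pi x}$, $e_x(y):=e(xy)$; $I_1=[0,1]$, $I_2=[\alpha,\beta]$. The maximal momentum operator is $P=\frac{1}{i2\pi}\frac{d}{dt}$ on $L^2(I_1\cup I_2)$, with domain $\mathscr{D}(P)$ the absolutely continuous functions $f$ on $I_1\cup I_2$ with $f'\in L^2(I_1\cup I_2)$. For $0\le w\le 1$ and $\phi,\psi,\theta\in\mathbb{R}$, $$B=B(w,\phi,\psi,\theta)=\begin{pmatrix} w\,e(\phi) & -\sqrt{1-w^2}\,e(\theta-\psi)\\ \sqrt{1-w^2}\,e(\psi) & w\,e(\theta-\phi)\end{pmatrix},$$ and $P_B$ is the restriction of $P$ to $\mathscr{D}(P_B)=\{f\in\mathscr{D}(P) : B\,(f(1),f(\beta))^T=(f(0),f(\alpha))^T\}$. Every eigenfunction of $P_B$ with eigenvalue $\lambda$ is of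 the form $(a_\lambda\chi_{[0,1]}+b_\lambda\chi_{[\alpha,\beta]})e_\lambda$ with $a_\lambda,b_\lambda\in\mathbb{C}$. $P_B$ is called spectral if $a_\lambda=b_\lambda$ for all $\lambda\in\Lambda_B$ (i.e. for every eigenfunction). *)

theory Defs
  imports "HOL-Analysis.Analysis"
begin

text \<open>Elements of \<open>L\<^sup>2(M)\<close> are represented by functions; equality in \<open>L\<^sup>2(M)\<close> is
  equality almost everywhere, and is always written out as such.\<close>

definition L2 :: "'a measure \<Rightarrow> ('a \<Rightarrow> complex) set" where
  "L2 M = {f \<in> borel_measurable M. integrable M (\<lambda>x. (norm (f x))\<^sup>2)}"

definition L2_norm :: "'a measure \<Rightarrow> ('a \<Rightarrow> complex) \<Rightarrow> real" where
  "L2_norm M f = sqrt (LINT x|M. (norm (f x))\<^sup>2)"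

text \<open>An unbounded operator on \<open>L\<^sup>2(M)\<close> is given by its domain \<open>D\<close> and its action \<open>T\<close>.
  A number \<open>z\<close> belongs to the resolvent set if \<open>T - z\<close> maps \<open>D\<close> bijectively onto \<open>L\<^sup>2(M)\<close>
  and the inverse is bounded.\<close>

definition resolvent_set ::
    "'a measure \<Rightarrow> ('a \<Rightarrow> complex) set \<Rightarrow> (('a \<Rightarrow> complex) \<Rightarrow> ('a \<Rightarrow> complex)) \<Rightarrow> complex set" where
  "resolvent_set M D T = {z.
     (\<forall>h\<in>L2 M. \<exists>f\<in>D. (AE x in M. T f x - z * f x = h x) \<and>
        (\<forall>f'\<in>D. (AE x in M. T f' x - z * f' x = h x) \<longrightarrow> (AE x in M. f' x = f x))) \<and>
     (\<exists>C. \<forall>f\<in>D. L2_norm M f \<le> C * L2_norm M (\<lambda>x. T f x - z * f x))}"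

definition operator_spectrum ::
    "'a measure \<Rightarrow> ('a \<Rightarrow> complex) set \<Rightarrow> (('a \<Rightarrow> complex) \<Rightarrow> ('a \<Rightarrow> complex)) \<Rightarrow> complex set" where
  "operator_spectrum M D T = - resolvent_set M D T"

definition eigenfunction ::
    "'a measure \<Rightarrow> ('a \<Rightarrow> complex) set \<Rightarrow> (('a \<Rightarrow> complex) \<Rightarrow> ('a \<Rightarrow> complex)) \<Rightarrow>
     complex \<Rightarrow> ('a \<Rightarrow> complex) \<Rightarrow> bool" where
  "eigenfunction M D T z f \<longleftrightarrow>
     f \<in> D \<and> \<not> (AE x in M. f x = 0) \<and> (AE x in M. T f x = z * f x)"

text \<open>Absolute continuity of a function of a real variable (the library constant
  \<open>absolutely_continuous\<close> is about measures). The set \<open>\<D>\<close> is an arbitrary finite family of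
  non-overlapping compact intervals contained in \<open>S\<close>.\<close>

definition abs_continuous_on :: "real set \<Rightarrow> (real \<Rightarrow> complex) \<Rightarrow> bool" where
  "abs_continuous_on S f \<longleftrightarrow>
     (\<forall>\<epsilon>>0. \<exists>\<delta>>0. \<forall>\<D> t. \<D> division_of t \<and> t \<subseteq> S \<and> (\<Sum>K\<in>\<D>. measure lborel K) < \<delta> \<longrightarrow>
        (\<Sum>K\<in>\<D>. norm (f (Sup K) - f (Inf K))) < \<epsilon>)"

definition ee :: "complex \<Rightarrow> complex" where
  "ee z = exp (\<i> * 2 * complex_of_real pi * z)"

definition two_intervals :: "real \<Rightarrow> real \<Rightarrow> real set" where
  "two_intervals \<alpha> \<beta> = {0..1} \<union> {\<alpha>..\<beta>}"

definition P_domain :: "real \<Rightarrow> real \<Rightarrow> (real \<Rightarrow> complex) set" where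
  "P_domain \<alpha> \<beta> = {f. abs_continuous_on (two_intervals \<alpha> \<beta>) f \<and>
     (\<exists>g\<in>L2 (lebesgue_on (two_intervals \<alpha> \<beta>)).
        AE x in lebesgue_on (two_intervals \<alpha> \<beta>). (f has_vector_derivative g x) (at x))}"

text \<open>Only the values at points of differentiability matter: for \<open>f\<close> in the domain these
  are almost all points of the two intervals.\<close>

definition momentum_op :: "(real \<Rightarrow> complex) \<Rightarrow> real \<Rightarrow> complex" where
  "momentum_op f = (\<lambda>x. 1 / (\<i> * 2 * complex_of_real pi) * vector_derivative f (at x))"

definition B_matrix :: "real \<Rightarrow> real \<Rightarrow> real \<Rightarrow> real \<Rightarrow> complex^2^2" where
  "B_matrix w \<phi> \<psi> \<theta> = vector [
     vector [of_real w * ee (of_real \<phi>), - of_real (sqrt (1 - w\<^sup>2)) * ee (of_real (\<theta> - \<psi>))],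
     vector [of_real (sqrt (1 - w\<^sup>2)) * ee (of_real \<psi>), of_real w * ee (of_real (\<theta> - \<phi>))]]"

definition PB_domain :: "real \<Rightarrow> real \<Rightarrow> complex^2^2 \<Rightarrow> (real \<Rightarrow> complex) set" where
  "PB_domain \<alpha> \<beta> A = {f \<in> P_domain \<alpha> \<beta>. A *v vector [f 1, f \<beta>] = vector [f 0, f \<alpha>]}"

definition PB_spectrum :: "real \<Rightarrow> real \<Rightarrow> complex^2^2 \<Rightarrow> complex set" where
  "PB_spectrum \<alpha> \<beta> A =
     operator_spectrum (lebesgue_on (two_intervals \<alpha> \<beta>)) (PB_domain \<alpha> \<beta> A) momentum_op"

definition PB_eigenfunction ::
    "real \<Rightarrow> real \<Rightarrow> complex^2^2 \<Rightarrow> complex \<Rightarrow> (real \<Rightarrow> complex) \<Rightarrow> bool" where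
  "PB_eigenfunction \<alpha> \<beta> A =
     eigenfunction (lebesgue_on (two_intervals \<alpha> \<beta>)) (PB_domain \<alpha> \<beta> A) momentum_op"

text \<open>Every eigenfunction agrees on the two intervals with a function of the form below.\<close>

definition PB_spectral :: "real \<Rightarrow> real \<Rightarrow> complex^2^2 \<Rightarrow> bool" where
  "PB_spectral \<alpha> \<beta> A \<longleftrightarrow> (\<forall>\<mu>\<in>PB_spectrum \<alpha> \<beta> A. \<forall>a b.
     PB_eigenfunction \<alpha> \<beta> A \<mu>
       (\<lambda>x. (a * indicator {0..1} x + b * indicator {\<alpha>..\<beta>} x) * ee (\<mu> * of_real x))
     \<longrightarrow> a = b)"

end

theory Submission
  imports Defs
begin

text \<open>
  Apart from the boundary condition, the equation \<open>P f - z f = h\<close> is a first-order linear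
  differential equation on each of the two intervals, so by Duhamel's formula \<open>f\<close> is
  determined by its values at the left end points \<open>0\<close> and \<open>\<alpha>\<close>, and these may be
  prescribed freely (\<open>resolvent_eq_iff_propagated\<close>). The values at the right end points are
  then \<open>D v + r\<close>, where \<open>v = (f 0, f \<alpha>)\<close>, \<open>D\<close> is the diagonal
  matrix with entries \<open>e z\<close> and \<open>e (z (\<beta> - \<alpha>))\<close>, and \<open>r\<close>
  depends only on \<open>h\<close>. The boundary condition becomes the \<open>2 \<times> 2\<close>
  linear system \<open>(1 - B D) v = B r\<close>. If its determinant is nonzero, it has a unique
  solution that is bounded in terms of the \<open>L\<^sup>2\<close> norm of \<open>h\<close>, so \<open>z\<close> is in the
  resolvent set; if it vanishes, a vector in the kernel gives an eigenfunction. Hence, for every boundary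
  matrix, the spectrum is the zero set of that determinant (\<open>PB_spectrum_eq_det\<close>).

  Two facts about absolutely continuous functions justify the use of Duhamel's formula:
  such a function is the integral of its almost everywhere derivative
  (\<open>abs_continuous_on_has_integral_derivative\<close>), and conversely the indefinite integral
  of a square integrable function is absolutely continuous and has the integrand as its derivative
  almost everywhere (\<open>abs_continuous_on_indefinite_integral\<close> and
  \<open>indefinite_integral_has_vector_derivative_ae\<close>).

  For \<open>w = 0\<close> the determinant is \<open>1 + e (\<theta> + z (1 + \<beta> - \<alpha>))\<close>, which
  yields the arithmetic progression of the theorem as the spectrum. At each of its points \<open>z\<close>,
  a piecewise exponential is an eigenfunction iff it has a nonzero amplitude \<open>a\<close> on the first
  interval and the amplitude \<open>b = a e (\<psi> + z (1 - \<alpha>))\<close> on the second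
  (\<open>PB_eigenfunction_w_zero_iff\<close>). Thus \<open>P\<^sub>B\<close> is spectral iff
  \<open>\<psi> + z (1 - \<alpha>)\<close> is an integer for every point \<open>z\<close> of the progression.
  That is the case iff it is an integer at one point and the increment
  \<open>(1 - \<alpha>) / (1 + \<beta> - \<alpha>) = 1 - \<beta> / (1 + \<beta> - \<alpha>)\<close>
  is an integer, which are the two conditions of the theorem.
\<close>

section \<open>Absolutely continuous functions\<close>

lemma AE_lebesgue_on_iff_negligible:
  fixes S :: "real set"
  assumes "S \<in> sets lebesgue"
  shows "(AE x in lebesgue_on S. P x) \<longleftrightarrow> negligible {x \<in> S. \<not> P x}"
proof -
  have "S \<inter> space lebesgue \<in> sets lebesgue"
    using assms by simp
  then have "(AE x in lebesgue_on S. P x) \<longleftrightarrow> (AE x in lebesgue. x \<in> S \<longrightarrow> P x)"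
    by (rule AE_restrict_space_iff)
  also have "\<dots> \<longleftrightarrow> {x \<in> space lebesgue. \<not> (x \<in> S \<longrightarrow> P x)} \<in> null_sets lebesgue"
    by (rule completion.AE_iff_null_sets)
  also have "{x \<in> space lebesgue. \<not> (x \<in> S \<longrightarrow> P x)} = {x \<in> S. \<not> P x}"
    by auto
  finally show ?thesis by (simp add: negligible_iff_null_sets)
qed

lemma division_realE:
  fixes K :: "real set"
  assumes "\<D> division_of t" "K \<in> \<D>"
  obtains u v where "K = {u..v}" "u \<le> v" "{u..v} \<subseteq> t" "Inf K = u" "Sup K = v"
    "measure lborel K = v - u"
proof -
  obtain u v where "K = cbox u v" "K \<noteq> {}" "K \<subseteq> t"
    using division_ofD[OF assms(1)] assms(2) by metis
  then show ?thesis by (intro that[of u v]) auto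
qed

text \<open>The intervals overlap only in end points, so their total length is the measure of their
  union.\<close>
lemma division_measure_le:
  fixes T :: "real set"
  assumes "\<D> division_of t" "t \<subseteq> T" "T \<in> lmeasurable"
  shows "(\<Sum>K\<in>\<D>. measure lborel K) \<le> measure lebesgue T"
proof -
  have "((\<lambda>x. 1::real) has_integral measure lborel K) K" if K: "K \<in> \<D>" for K
    using division_realE[OF assms(1) K] has_integral_const_real[of "1::real"] by (metis content_real real_scaleR_def mult.right_neutral)
  then have "((\<lambda>x. 1::real) has_integral (\<Sum>K\<in>\<D>. measure lborel K)) t"
    by (rule has_integral_combine_division[OF assms(1)])
  moreover have t: "t \<in> lmeasurable"
    using division_ofD[OF assms(1)] by (metis compact_Union compact_cbox lmeasurable_compact)
  ultimately have "(\<Sum>K\<in>\<D>. measure lborel K) = measure lebesgue t"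
    by (metis integral_unique lmeasure_integral)
  also have "\<dots> \<le> measure lebesgue T"
    using assms t by (intro measure_mono_fmeasurable) (auto simp: fmeasurableD)
  finally show ?thesis .
qed

lemma abs_continuous_onD:
  assumes "abs_continuous_on S f" "\<epsilon> > 0"
  obtains \<delta> where "\<delta> > 0"
    "\<And>\<D> t. \<D> division_of t \<Longrightarrow> t \<subseteq> S \<Longrightarrow> (\<Sum>K\<in>\<D>. measure lborel K) < \<delta> \<Longrightarrow>
        (\<Sum>K\<in>\<D>. norm (f (Sup K) - f (Inf K))) < \<epsilon>"
  using assms unfolding abs_continuous_on_def by meson

lemma abs_continuous_on_subset:
  "abs_continuous_on S f \<Longrightarrow> T \<subseteq> S \<Longrightarrow> abs_continuous_on T f"
  unfolding abs_continuous_on_def by (meson subset_trans)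

lemma abs_continuous_on_cong:
  assumes "abs_continuous_on S f" "\<And>x. x \<in> S \<Longrightarrow> g x = f x"
  shows "abs_continuous_on S g"
proof -
  have eq: "(\<Sum>K\<in>\<D>. norm (g (Sup K) - g (Inf K))) = (\<Sum>K\<in>\<D>. norm (f (Sup K) - f (Inf K)))"
    if dt: "\<D> division_of t" "t \<subseteq> S" for \<D> t
  proof (rule sum.cong[OF refl])
    fix K assume "K \<in> \<D>"
    obtain u v where "K = {u..v}" "u \<le> v" "{u..v} \<subseteq> t" "Inf K = u" "Sup K = v"
        "measure lborel K = v - u"
      by (rule division_realE[OF dt(1) \<open>K \<in> \<D>\<close>])
    with dt(2) show "norm (g (Sup K) - g (Inf K)) = norm (f (Sup K) - f (Inf K))"
      using assms(2)[of u] assms(2)[of v] by (simp add: subset_iff)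
  qed
  show ?thesis
    unfolding abs_continuous_on_def
  proof (intro allI impI)
    fix \<epsilon> :: real assume "\<epsilon> > 0"
    then obtain \<delta> where \<delta>: "\<delta> > 0"
      "\<And>\<D> t. \<D> division_of t \<Longrightarrow> t \<subseteq> S \<Longrightarrow> (\<Sum>K\<in>\<D>. measure lborel K) < \<delta> \<Longrightarrow>
        (\<Sum>K\<in>\<D>. norm (f (Sup K) - f (Inf K))) < \<epsilon>"
      by (rule abs_continuous_onD[OF assms(1)]) blast
    show "\<exists>\<delta>>0. \<forall>\<D> t. \<D> division_of t \<and> t \<subseteq> S \<and> (\<Sum>K\<in>\<D>. measure lborel K) < \<delta> \<longrightarrow>
        (\<Sum>K\<in>\<D>. norm (g (Sup K) - g (Inf K))) < \<epsilon>"
    proof (intro exI[of _ \<delta>] conjI allI impI)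
      fix \<D> t assume "\<D> division_of t \<and> t \<subseteq> S \<and> (\<Sum>K\<in>\<D>. measure lborel K) < \<delta>"
      then show "(\<Sum>K\<in>\<D>. norm (g (Sup K) - g (Inf K))) < \<epsilon>"
        using \<delta>(2)[of \<D> t] eq[of \<D> t] by simp
    qed (fact \<delta>(1))
  qed
qed

lemma abs_continuous_on_imp_continuous_on:
  assumes "abs_continuous_on {l..r} f"
  shows "continuous_on {l..r} f"
  unfolding continuous_on_iff
proof (intro ballI allI impI)
  fix x \<epsilon> :: real assume x: "x \<in> {l..r}" and e: "\<epsilon> > 0"
  obtain \<delta> where \<delta>: "\<delta> > 0"
    "\<And>\<D> t. \<D> division_of t \<Longrightarrow> t \<subseteq> {l..r} \<Longrightarrow> (\<Sum>K\<in>\<D>. measure lborel K) < \<delta> \<Longrightarrow>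
        (\<Sum>K\<in>\<D>. norm (f (Sup K) - f (Inf K))) < \<epsilon>"
    by (rule abs_continuous_onD[OF assms e]) blast
  have *: "norm (f v - f u) < \<epsilon>" if "l \<le> u" "u \<le> v" "v \<le> r" "v - u < \<delta>" for u v
    using \<delta>(2)[of "{{u..v}}" "{u..v}"] that division_of_self[of u v] by (auto simp: box_real)
  show "\<exists>d>0. \<forall>x'\<in>{l..r}. dist x' x < d \<longrightarrow> dist (f x') (f x) < \<epsilon>"
  proof (intro exI[of _ \<delta>] conjI ballI impI)
    fix y assume y: "y \<in> {l..r}" "dist y x < \<delta>"
    show "dist (f y) (f x) < \<epsilon>"
      using *[of x y] *[of y x] x y by (cases "x \<le> y") (auto simp: dist_norm norm_minus_commute)
  qed (fact \<delta>(1))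
qed

text \<open>With bounds \<open>C\<close> for \<open>f\<close> and \<open>D\<close> for \<open>g\<close>, an increment of the
  product is at most \<open>D\<close> times that of \<open>f\<close> plus \<open>C\<close> times that of
  \<open>g\<close>.\<close>
lemma abs_continuous_on_mult:
  assumes f: "abs_continuous_on S f" "bounded (f ` S)"
    and g: "abs_continuous_on S g" "bounded (g ` S)"
  shows "abs_continuous_on S (\<lambda>x. f x * g x)"
  unfolding abs_continuous_on_def
proof (intro allI impI)
  fix \<epsilon> :: real assume "\<epsilon> > 0"
  obtain C where C: "C > 0" "\<And>x. x \<in> S \<Longrightarrow> norm (f x) \<le> C"
    using f(2) bounded_pos by (metis imageI)
  obtain D where D: "D > 0" "\<And>x. x \<in> S \<Longrightarrow> norm (g x) \<le> D"
    using g(2) bounded_pos by (metis imageI)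
  obtain \<delta>1 where \<delta>1: "\<delta>1 > 0" "\<And>\<D> t. \<D> division_of t \<Longrightarrow> t \<subseteq> S \<Longrightarrow> (\<Sum>K\<in>\<D>. measure lborel K) < \<delta>1 \<Longrightarrow>
        (\<Sum>K\<in>\<D>. norm (f (Sup K) - f (Inf K))) < \<epsilon> / (2 * D)"
    by (rule abs_continuous_onD[OF f(1), of "\<epsilon> / (2 * D)"]) (use \<open>\<epsilon> > 0\<close> D in auto)
  obtain \<delta>2 where \<delta>2: "\<delta>2 > 0" "\<And>\<D> t. \<D> division_of t \<Longrightarrow> t \<subseteq> S \<Longrightarrow> (\<Sum>K\<in>\<D>. measure lborel K) < \<delta>2 \<Longrightarrow>
        (\<Sum>K\<in>\<D>. norm (g (Sup K) - g (Inf K))) < \<epsilon> / (2 * C)"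
    by (rule abs_continuous_onD[OF g(1), of "\<epsilon> / (2 * C)"]) (use \<open>\<epsilon> > 0\<close> C in auto)
  show "\<exists>\<delta>>0. \<forall>\<D> t. \<D> division_of t \<and> t \<subseteq> S \<and> (\<Sum>K\<in>\<D>. measure lborel K) < \<delta> \<longrightarrow>
      (\<Sum>K\<in>\<D>. norm (f (Sup K) * g (Sup K) - f (Inf K) * g (Inf K))) < \<epsilon>"
  proof (intro exI[of _ "min \<delta>1 \<delta>2"] conjI allI impI)
    fix \<D> t assume H: "\<D> division_of t \<and> t \<subseteq> S \<and> (\<Sum>K\<in>\<D>. measure lborel K) < min \<delta>1 \<delta>2"
    have "(\<Sum>K\<in>\<D>. norm (f (Sup K) * g (Sup K) - f (Inf K) * g (Inf K)))
      \<le> (\<Sum>K\<in>\<D>. D * norm (f (Sup K) - f (Inf K)) + C * norm (g (Sup K) - g (Inf K)))"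
    proof (rule sum_mono)
      fix K assume "K \<in> \<D>"
      have div: "\<D> division_of t" and t: "t \<subseteq> S" using H by blast+
      obtain u v where K: "K = {u..v}" "u \<le> v" "{u..v} \<subseteq> t" "Inf K = u" "Sup K = v"
          "measure lborel K = v - u"
        by (rule division_realE[OF div \<open>K \<in> \<D>\<close>])
      then have uv: "u \<in> S" "v \<in> S" using t by (auto simp: subset_iff)
      have "f v * g v - f u * g u = (f v - f u) * g v + f u * (g v - g u)"
        by (simp add: algebra_simps)
      also have "norm \<dots> \<le> norm (f v - f u) * norm (g v) + norm (f u) * norm (g v - g u)"
        by (metis norm_triangle_ineq norm_mult)
      also have "\<dots> \<le> norm (f v - f u) * D + C * norm (g v - g u)"
        using C D uv by (intro add_mono mult_mono) auto
      finally show "norm (f (Sup K) * g (Sup K) - f (Inf K) * g (Inf K)) \<le>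
          D * norm (f (Sup K) - f (Inf K)) + C * norm (g (Sup K) - g (Inf K))"
        by (simp add: K mult.commute)
    qed
    also have "\<dots> = D * (\<Sum>K\<in>\<D>. norm (f (Sup K) - f (Inf K))) + C * (\<Sum>K\<in>\<D>. norm (g (Sup K) - g (Inf K)))"
      by (simp add: sum.distrib sum_distrib_left)
    also have "\<dots> < D * (\<epsilon> / (2 * D)) + C * (\<epsilon> / (2 * C))"
    proof (intro add_strict_mono mult_strict_left_mono)
      show "(\<Sum>K\<in>\<D>. norm (f (Sup K) - f (Inf K))) < \<epsilon> / (2 * D)"
        by (rule \<delta>1(2)[of \<D> t]) (use H in simp_all)
      show "(\<Sum>K\<in>\<D>. norm (g (Sup K) - g (Inf K))) < \<epsilon> / (2 * C)"
        by (rule \<delta>2(2)[of \<D> t]) (use H in simp_all)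
    qed (fact C(1) D(1))+
    also have "\<dots> = \<epsilon>" using C D by simp
    finally show "(\<Sum>K\<in>\<D>. norm (f (Sup K) * g (Sup K) - f (Inf K) * g (Inf K))) < \<epsilon>" .
  qed (simp add: \<delta>1(1) \<delta>2(1))
qed

lemma abs_continuous_on_mult_interval:
  assumes "abs_continuous_on {l..r} f" "abs_continuous_on {l..r} g"
  shows "abs_continuous_on {l..r} (\<lambda>x. f x * g x)"
  using assms by (intro abs_continuous_on_mult compact_imp_bounded compact_continuous_image
      abs_continuous_on_imp_continuous_on) auto

text \<open>The intervals of a division are connected, so each of them lies in one of the two components, and a
  division splits into one of each component.\<close>
lemma abs_continuous_on_two_intervals:
  assumes "1 < \<alpha>" and f: "abs_continuous_on {0..1} f" "abs_continuous_on {\<alpha>..\<beta>} f"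
  shows "abs_continuous_on (two_intervals \<alpha> \<beta>) f"
  unfolding abs_continuous_on_def
proof (intro allI impI)
  fix \<epsilon> :: real assume "\<epsilon> > 0"
  obtain \<delta>1 where \<delta>1: "\<delta>1 > 0" "\<And>\<D> t. \<D> division_of t \<Longrightarrow> t \<subseteq> {0..1} \<Longrightarrow> (\<Sum>K\<in>\<D>. measure lborel K) < \<delta>1 \<Longrightarrow>
        (\<Sum>K\<in>\<D>. norm (f (Sup K) - f (Inf K))) < \<epsilon> / 2"
    by (rule abs_continuous_onD[OF f(1), of "\<epsilon> / 2"]) (use \<open>\<epsilon> > 0\<close> in auto)
  obtain \<delta>2 where \<delta>2: "\<delta>2 > 0" "\<And>\<D> t. \<D> division_of t \<Longrightarrow> t \<subseteq> {\<alpha>..\<beta>} \<Longrightarrow> (\<Sum>K\<in>\<D>. measure lborel K) < \<delta>2 \<Longrightarrow>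
        (\<Sum>K\<in>\<D>. norm (f (Sup K) - f (Inf K))) < \<epsilon> / 2"
    by (rule abs_continuous_onD[OF f(2), of "\<epsilon> / 2"]) (use \<open>\<epsilon> > 0\<close> in auto)
  show "\<exists>\<delta>>0. \<forall>\<D> t. \<D> division_of t \<and> t \<subseteq> two_intervals \<alpha> \<beta> \<and> (\<Sum>K\<in>\<D>. measure lborel K) < \<delta> \<longrightarrow>
      (\<Sum>K\<in>\<D>. norm (f (Sup K) - f (Inf K))) < \<epsilon>"
  proof (intro exI[of _ "min \<delta>1 \<delta>2"] conjI allI impI)
    fix \<D> t assume "\<D> division_of t \<and> t \<subseteq> two_intervals \<alpha> \<beta> \<and> (\<Sum>K\<in>\<D>. measure lborel K) < min \<delta>1 \<delta>2"
    then have div: "\<D> division_of t" and t: "t \<subseteq> two_intervals \<alpha> \<beta>"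
      and small: "(\<Sum>K\<in>\<D>. measure lborel K) < min \<delta>1 \<delta>2" by auto
    have fin: "finite \<D>" using div by blast
    define \<D>1 where "\<D>1 = {K \<in> \<D>. K \<subseteq> {0..1}}"
    define \<D>2 where "\<D>2 = {K \<in> \<D>. K \<subseteq> {\<alpha>..\<beta>}}"
    have "K \<subseteq> {0..1} \<or> K \<subseteq> {\<alpha>..\<beta>}" if "K \<in> \<D>" for K
    proof -
      obtain u v where K: "K = {u..v}" "u \<le> v" "{u..v} \<subseteq> t" "Inf K = u" "Sup K = v"
          "measure lborel K = v - u"
        by (rule division_realE[OF div \<open>K \<in> \<D>\<close>])
      then have "u \<in> two_intervals \<alpha> \<beta>" "v \<in> two_intervals \<alpha> \<beta>" using t by auto
      \<comment> \<open>An interval meeting both components would contain every point of the gap.\<close>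
      moreover obtain g where g: "1 < g" "g < \<alpha>" using \<open>1 < \<alpha>\<close> dense by blast
      moreover have "g \<notin> {u..v}"
      proof -
        have "g \<notin> two_intervals \<alpha> \<beta>"
          using g by (simp add: two_intervals_def)
        then show ?thesis using K(3) t by blast
      qed
      ultimately show ?thesis
        using \<open>1 < \<alpha>\<close> unfolding K(1) two_intervals_def Un_iff atLeastAtMost_iff atLeastatMost_subset_iff
        by (smt (verit))
    qed
    then have un: "\<D> = \<D>1 \<union> \<D>2" unfolding \<D>1_def \<D>2_def by blast
    have sub: "(\<Sum>K\<in>\<D>'. measure lborel K) \<le> (\<Sum>K\<in>\<D>. measure lborel K)" if "\<D>' \<subseteq> \<D>" for \<D>'
      using that fin by (intro sum_mono2) auto
    have "(\<Sum>K\<in>\<D>. norm (f (Sup K) - f (Inf K)))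
       \<le> (\<Sum>K\<in>\<D>1. norm (f (Sup K) - f (Inf K))) + (\<Sum>K\<in>\<D>2. norm (f (Sup K) - f (Inf K)))"
    proof -
      have "finite \<D>1" "finite \<D>2" using fin by (auto simp: \<D>1_def \<D>2_def)
      then show ?thesis
        using sum_Un[of \<D>1 \<D>2 "\<lambda>K. norm (f (Sup K) - f (Inf K))"]
        by (simp add: un[symmetric] sum_nonneg)
    qed
    also have "\<dots> < \<epsilon> / 2 + \<epsilon> / 2"
    proof (rule add_strict_mono)
      show "(\<Sum>K\<in>\<D>1. norm (f (Sup K) - f (Inf K))) < \<epsilon> / 2"
      proof (rule \<delta>1(2))
        show "\<D>1 division_of \<Union>\<D>1"
          by (rule division_of_subset[OF division_of_union_self[OF div]]) (use un in blast)
        show "\<Union>\<D>1 \<subseteq> {0..1}" by (auto simp: \<D>1_def)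
        show "(\<Sum>K\<in>\<D>1. measure lborel K) < \<delta>1" using sub[of \<D>1] small un by auto
      qed
      show "(\<Sum>K\<in>\<D>2. norm (f (Sup K) - f (Inf K))) < \<epsilon> / 2"
      proof (rule \<delta>2(2))
        show "\<D>2 division_of \<Union>\<D>2"
          by (rule division_of_subset[OF division_of_union_self[OF div]]) (use un in blast)
        show "\<Union>\<D>2 \<subseteq> {\<alpha>..\<beta>}" by (auto simp: \<D>2_def)
        show "(\<Sum>K\<in>\<D>2. measure lborel K) < \<delta>2" using sub[of \<D>2] small un by auto
      qed
    qed
    finally show "(\<Sum>K\<in>\<D>. norm (f (Sup K) - f (Inf K))) < \<epsilon>" by simp
  qed (simp add: \<delta>1(1) \<delta>2(1))
qed

text \<open>
  The gauge integral makes this direct. Set the integrand to zero on the exceptional set \<open>N\<close>. At a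
  tag outside \<open>N\<close> the gauge comes from differentiability, and the increment of \<open>f\<close>
  differs from the term of the Riemann sum by a small multiple of the length. At a tag in \<open>N\<close> the
  gauge keeps the interval inside an open set \<open>T \<supseteq> N\<close> of small measure; the increments of
  \<open>f\<close> over these intervals have a small sum by absolute continuity.
\<close>
lemma abs_continuous_on_has_integral_derivative:
  fixes f g :: "real \<Rightarrow> complex"
  assumes "a \<le> b" and ac: "abs_continuous_on {a..b} f" and N: "negligible N"
    and der: "\<And>x. x \<in> {a..b} - N \<Longrightarrow> (f has_vector_derivative g x) (at x within {a..b})"
  shows "(g has_integral f b - f a) {a..b}"
proof -
  define h where "h = (\<lambda>x. if x \<in> N then 0 else g x)"
  have "(h has_integral f b - f a) {a..b}"
    unfolding has_integral_real
  proof (intro allI impI)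
    fix e :: real assume "e > 0"
    \<comment> \<open>The summand \<open>1\<close> keeps the denominator positive when \<open>a = b\<close>.\<close>
    define \<eta> where "\<eta> = e / (2 * (b - a + 1))"
    have \<eta>: "\<eta> > 0" "\<eta> * (b - a) < e / 2"
      using \<open>e > 0\<close> \<open>a \<le> b\<close> by (simp_all add: \<eta>_def field_simps)
    have e2: "e / 2 > 0" using \<open>e > 0\<close> by simp
    obtain \<delta> where \<delta>: "\<delta> > 0"
      "\<And>\<D> t. \<D> division_of t \<Longrightarrow> t \<subseteq> {a..b} \<Longrightarrow> (\<Sum>K\<in>\<D>. measure lborel K) < \<delta> \<Longrightarrow>
        (\<Sum>K\<in>\<D>. norm (f (Sup K) - f (Inf K))) < e / 2"
      by (rule abs_continuous_onD[OF ac e2]) blast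
    obtain T where T: "open T" "N \<subseteq> T" "T \<in> lmeasurable" "measure lebesgue T < \<delta>"
    proof -
      obtain T where T: "open T" "N \<subseteq> T" "T - N \<in> lmeasurable" "emeasure lebesgue (T - N) < ennreal \<delta>"
        using sets_lebesgue_outer_open[OF negligible_imp_sets[OF N] \<delta>(1)] .
      have T_eq: "T = (T - N) \<union> N" using T(2) by blast
      have "T \<in> lmeasurable"
        using T(3) negligible_imp_measurable[OF N] T_eq by (metis fmeasurable.Un)
      moreover have "measure lebesgue T = measure lebesgue (T - N)"
        using measure_Un_null_set[of "T - N" lebesgue N] T(3) N T_eq
        by (simp add: fmeasurableD negligible_iff_null_sets)
      moreover have "measure lebesgue (T - N) < \<delta>"
        using T(3,4) \<delta>(1) by (simp add: emeasure_eq_measure2 ennreal_less_iff)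
      ultimately show ?thesis using that T by metis
    qed
    have "\<exists>d>0. (x \<in> N \<longrightarrow> ball x d \<subseteq> T) \<and>
        (x \<in> {a..b} - N \<longrightarrow> (\<forall>y\<in>{a..b}. norm (y - x) < d \<longrightarrow>
           norm (f y - f x - (y - x) *\<^sub>R g x) \<le> \<eta> * norm (y - x)))" for x
    proof -
      consider "x \<in> N" | "x \<in> {a..b} - N" | "x \<notin> {a..b}" "x \<notin> N" by blast
      then show ?thesis
      proof cases
        case 1
        then show ?thesis using T openE by (metis Diff_iff subsetD)
      next
        case 2
        then show ?thesis
          using der[OF 2] \<eta>(1) unfolding has_vector_derivative_def has_derivative_within_alt by blast
      next
        case 3
        then show ?thesis by (intro exI[of _ 1]) auto
      qed
    qed
    then obtain d where d: "\<And>x. d x > 0" "\<And>x. x \<in> N \<Longrightarrow> ball x (d x) \<subseteq> T"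
      "\<And>x y. x \<in> {a..b} - N \<Longrightarrow> y \<in> {a..b} \<Longrightarrow> norm (y - x) < d x \<Longrightarrow>
           norm (f y - f x - (y - x) *\<^sub>R g x) \<le> \<eta> * norm (y - x)"
      by metis
    show "\<exists>\<gamma>. gauge \<gamma> \<and> (\<forall>\<D>. \<D> tagged_division_of {a..b} \<and> \<gamma> fine \<D> \<longrightarrow>
        norm ((\<Sum>(x, k)\<in>\<D>. measure lborel k *\<^sub>R h x) - (f b - f a)) < e)"
    proof (intro exI[of _ "\<lambda>x. ball x (d x)"] conjI allI impI)
      show "gauge (\<lambda>x. ball x (d x))" using d(1) gauge_ball_dependent by blast
    next
      fix p assume "p tagged_division_of {a..b} \<and> (\<lambda>x. ball x (d x)) fine p"
      then have p: "p tagged_division_of {a..b}" and fine: "(\<lambda>x. ball x (d x)) fine p" by auto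
      have fin: "finite p" using p by blast
      have ba: "b - a = (\<Sum>(x,K)\<in>p. Sup K - Inf K)" "f b - f a = (\<Sum>(x,K)\<in>p. f (Sup K) - f (Inf K))"
        using additive_tagged_division_1[where f= "\<lambda>x. x"] additive_tagged_division_1[where f= f]
              \<open>a \<le> b\<close> p by auto
      define err where "err = (\<lambda>(x, K). norm (measure lborel K *\<^sub>R h x - (f (Sup K) - f (Inf K))))"
      define p1 where "p1 = {(x, K) \<in> p. x \<in> N}"
      define p2 where "p2 = {(x, K) \<in> p. x \<notin> N}"
      have p12: "p = p1 \<union> p2" "p1 \<inter> p2 = {}" "p1 \<subseteq> p" "p2 \<subseteq> p" by (auto simp: p1_def p2_def)
      have inp: "\<exists>u v. K = {u..v} \<and> u \<le> v \<and> Inf K = u \<and> Sup K = v \<and> x \<in> K \<and> K \<subseteq> {a..b} \<and> K \<subseteq> ball x (d x)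
            \<and> measure lborel K = v - u"
        if xK: "(x, K) \<in> p" for x K
      proof -
        have "x \<in> K" "K \<subseteq> {a..b}" "\<exists>u v. K = cbox u v"
          using tagged_division_ofD[OF p] xK by blast+
        moreover have "K \<subseteq> ball x (d x)" using fine xK unfolding fine_def by blast
        ultimately obtain u v where "K = {u..v}" "x \<in> {u..v}" "K \<subseteq> {a..b}" "K \<subseteq> ball x (d x)"
          by (auto simp: box_real)
        then show ?thesis by (intro exI[of _ u] exI[of _ v]) auto
      qed
      have good: "sum err p2 \<le> \<eta> * (b - a)"
      proof -
        have "sum err p2 \<le> (\<Sum>(x,K)\<in>p2. \<eta> * (Sup K - Inf K))"
        proof (rule sum_mono, clarify)
          fix x K assume xK: "(x, K) \<in> p2"
          then have xN: "x \<notin> N" and "(x, K) \<in> p" by (auto simp: p2_def)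
          then obtain u v where K: "K = {u..v}" "u \<le> v" "Inf K = u" "Sup K = v" "x \<in> K" "K \<subseteq> {a..b}"
              "K \<subseteq> ball x (d x)" "measure lborel K = v - u"
            using inp by blast
          have u: "u \<in> K" "v \<in> K" using K(1,2) by auto
          have xab: "x \<in> {a..b} - N" and "u \<in> {a..b}" "v \<in> {a..b}" using K(5,6) xN u by auto
          moreover have "norm (u - x) < d x" "norm (v - x) < d x"
            using u K(7) by (auto simp: subset_iff dist_real_def)
          ultimately have bounds: "norm (f u - f x - (u - x) *\<^sub>R g x) \<le> \<eta> * norm (u - x)"
            "norm (f v - f x - (v - x) *\<^sub>R g x) \<le> \<eta> * norm (v - x)"
            using d(3) by blast+
          have "(v - u) *\<^sub>R g x - (f v - f u)
              = (f u - f x - (u - x) *\<^sub>R g x) - (f v - f x - (v - x) *\<^sub>R g x)"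
            by (simp add: algebra_simps)
          also have "norm \<dots> \<le> \<eta> * norm (u - x) + \<eta> * norm (v - x)"
            using bounds norm_triangle_ineq4 by (meson add_mono order_trans)
          also have "\<dots> = \<eta> * (v - u)"
            using K(1,5) by (simp add: algebra_simps)
          finally show "err (x, K) \<le> \<eta> * (Sup K - Inf K)"
            using K xN by (simp add: err_def h_def)
        qed
        also have "\<dots> \<le> (\<Sum>(x,K)\<in>p. \<eta> * (Sup K - Inf K))"
        proof (rule sum_mono2[OF fin p12(4)])
          fix q assume "q \<in> p - p2"
          then obtain x K where q: "q = (x, K)" "(x, K) \<in> p" by (metis DiffD1 surj_pair)
          then obtain u v where "u \<le> v" "Inf K = u" "Sup K = v" using inp by blast
          then show "0 \<le> (case q of (x, K) \<Rightarrow> \<eta> * (Sup K - Inf K))"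
            using \<eta>(1) q(1) by simp
        qed
        also have "\<dots> = \<eta> * (b - a)"
          unfolding ba(1) by (simp add: sum_distrib_left case_prod_unfold)
        finally show ?thesis .
      qed
      have bad: "sum err p1 < e / 2"
      proof -
        have part: "p1 tagged_partial_division_of {a..b}"
          by (rule tagged_partial_division_subset[OF conjunct1[OF p[unfolded tagged_division_of_def]] p12(3)])
        have tag: "p1 tagged_division_of \<Union>(snd ` p1)"
          by (rule tagged_partial_division_of_Union_self[OF part])
        have div: "snd ` p1 division_of \<Union>(snd ` p1)"
          by (rule partial_division_of_tagged_division[OF part])
        \<comment> \<open>The sum over tagged intervals becomes a sum over a division. Distinct tags may share a degenerate
          interval, which is harmless as its increment is zero. The value at the empty set is fixed
          because the transfer rule also asks about empty boxes.\<close>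
        define inc where "inc = (\<lambda>K. if K = {} then 0 else norm (f (Sup K) - f (Inf K)))"
        have ne: "K \<noteq> {}" if "(x, K) \<in> p1" for x K
          using tagged_partial_division_ofD(2)[OF part that] by blast
        have "sum err p1 = (\<Sum>(x,K)\<in>p1. inc K)"
          using ne by (intro sum.cong) (auto simp: p1_def err_def h_def inc_def norm_minus_commute)
        also have "\<dots> = (\<Sum>K\<in>snd ` p1. inc K)"
        proof (rule sum.over_tagged_division_lemma[OF tag])
          fix u v :: real assume "box u v = {}"
          then show "inc (cbox u v) = 0"
            by (cases "u = v") (auto simp: inc_def box_real)
        qed
        also have "\<dots> = (\<Sum>K\<in>snd ` p1. norm (f (Sup K) - f (Inf K)))"
          using ne by (intro sum.cong) (auto simp: inc_def)
        also have "\<dots> < e / 2"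
        proof (rule \<delta>(2)[OF div])
          show "\<Union>(snd ` p1) \<subseteq> {a..b}"
          proof (intro Union_least, clarsimp simp del: atLeastAtMost_iff)
            fix x K y assume "(x, K) \<in> p1" "y \<in> K"
            then show "y \<in> {a..b}" using inp[of x K] p12(3) by blast
          qed
          have "\<Union>(snd ` p1) \<subseteq> T"
          proof (intro Union_least, clarsimp)
            fix x K y assume "(x, K) \<in> p1" "y \<in> K"
            then have "x \<in> N" "K \<subseteq> ball x (d x)" using inp[of x K] unfolding p1_def by blast+
            with d(2)[of x] \<open>y \<in> K\<close> show "y \<in> T" by blast
          qed
          then show "(\<Sum>K\<in>snd ` p1. measure lborel K) < \<delta>"
            using division_measure_le[OF div _ T(3)] T(4) by linarith
        qed
        finally show ?thesis .
      qed
      have "(\<Sum>(x, k)\<in>p. measure lborel k *\<^sub>R h x) - (f b - f a)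
          = (\<Sum>(x, K)\<in>p. measure lborel K *\<^sub>R h x - (f (Sup K) - f (Inf K)))"
        unfolding ba(2) by (simp add: sum_subtractf case_prod_unfold)
      also have "norm \<dots> \<le> sum err p"
        unfolding err_def by (rule sum_norm_le) auto
      also have "\<dots> = sum err p1 + sum err p2"
        using fin p12 by (metis sum.union_disjoint finite_subset)
      also have "\<dots> < e" using good bad \<eta>(2) by linarith
      finally show "norm ((\<Sum>(x, k)\<in>p. measure lborel k *\<^sub>R h x) - (f b - f a)) < e" .
    qed
  qed
  then show ?thesis
    by (rule has_integral_spike[OF N, rotated]) (simp add: h_def)
qed

text \<open>The one-dimensional Lebesgue differentiation theorem. The library result
  \<open>integrable_ccontinuous_explicit\<close> gives the right derivative outside a null set; applied to the
  reflected integrand it gives the left derivative.\<close>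
lemma indefinite_integral_has_vector_derivative_ae:
  fixes g :: "real \<Rightarrow> complex"
  assumes g: "g integrable_on {l..r}"
  obtains N where "negligible N"
    "\<And>x. x \<in> {l<..<r} - N \<Longrightarrow> ((\<lambda>x. integral {l..x} g) has_vector_derivative g x) (at x)"
proof -
  \<comment> \<open>Extension by zero makes the integrand integrable on all compact intervals.\<close>
  define k where "k = (\<lambda>x. if x \<in> {l..r} then g x else 0)"
  have k_int: "k integrable_on {a..b}" for a b
  proof -
    have "k integrable_on UNIV" unfolding k_def using g integrable_restrict_UNIV by blast
    then show ?thesis using integrable_on_subinterval by blast
  qed
  have k_eq: "integral {u..v} k = integral {u..v} g" if "l \<le> u" "v \<le> r" for u v
    by (rule integral_cong) (use that in \<open>auto simp: k_def\<close>)
  obtain N1 where N1: "negligible N1"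
    "\<And>x e. x \<notin> N1 \<Longrightarrow> 0 < e \<Longrightarrow> \<exists>d>0. \<forall>h. 0 < h \<and> h < d \<longrightarrow>
        norm (integral {x..x + h} k /\<^sub>R h - k x) < e"
    using integrable_ccontinuous_explicit[of k] k_int by (auto simp: box_real)
  obtain N2 where N2: "negligible N2"
    "\<And>x e. x \<notin> N2 \<Longrightarrow> 0 < e \<Longrightarrow> \<exists>d>0. \<forall>h. 0 < h \<and> h < d \<longrightarrow>
        norm (integral {x..x + h} (\<lambda>x. k (-x)) /\<^sub>R h - k (-x)) < e"
  proof -
    have "(\<lambda>x. k (-x)) integrable_on {a..b}" for a b
      using Henstock_Kurzweil_Integration.integrable_reflect_real[of k "-a" "-b"] k_int by simp
    then show ?thesis
      using integrable_ccontinuous_explicit[of "\<lambda>x. k (-x)"] that by (auto simp: box_real)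
  qed
  have neg: "negligible (uminus ` N2)"
    by (intro negligible_differentiable_image_negligible[OF _ N2(1)]) (auto intro!: derivative_intros simp: differentiable_on_def)
  show ?thesis
  proof (rule that)
    show "negligible (N1 \<union> uminus ` N2)" using N1(1) neg by simp
  next
    fix x assume x: "x \<in> {l<..<r} - (N1 \<union> uminus ` N2)"
    then have lx: "l < x" "x < r" "x \<notin> N1" "- x \<notin> N2" by (auto simp: image_iff)
    have kx: "k x = g x" using lx by (simp add: k_def)
    show "((\<lambda>x. integral {l..x} g) has_vector_derivative g x) (at x)"
      unfolding has_vector_derivative_def has_derivative_at_alt
    proof (intro conjI allI impI)
      fix e :: real assume "e > 0"
      obtain d1 where d1: "d1 > 0" "\<And>h. 0 < h \<Longrightarrow> h < d1 \<Longrightarrow> norm (integral {x..x + h} k /\<^sub>R h - k x) < e"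
        using N1(2)[OF lx(3) \<open>e > 0\<close>] by blast
      obtain d2 where d2: "d2 > 0" "\<And>h. 0 < h \<Longrightarrow> h < d2 \<Longrightarrow>
          norm (integral {-x..-x + h} (\<lambda>x. k (-x)) /\<^sub>R h - k x) < e"
        using N2(2)[OF lx(4) \<open>e > 0\<close>] by auto
      define d where "d = Min {d1, d2, x - l, r - x}"
      have d: "d > 0" "d \<le> d1" "d \<le> d2" "d \<le> x - l" "d \<le> r - x"
        using d1(1) d2(1) lx by (auto simp: d_def)
      have mult: "norm (I - h *\<^sub>R c) \<le> e * h" if "h > 0" "norm (I /\<^sub>R h - c) < e" for I c :: complex and h
      proof -
        have "I - h *\<^sub>R c = h *\<^sub>R (I /\<^sub>R h - c)" using that(1) by (simp add: algebra_simps)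
        then have "norm (I - h *\<^sub>R c) = h * norm (I /\<^sub>R h - c)" using that(1) by simp
        also have "\<dots> \<le> h * e" using that by (intro mult_left_mono) auto
        finally show ?thesis by (simp add: mult.commute)
      qed
      have split: "integral {l..v} g - integral {l..u} g = integral {u..v} k" if "l \<le> u" "u \<le> v" "v \<le> r" for u v
      proof -
        have "g integrable_on {l..v}" using g that integrable_on_subinterval by (metis atLeastatMost_subset_iff order_refl)
        then show ?thesis
          using Henstock_Kurzweil_Integration.integral_combine[of l u v g] that k_eq[of u v]
          by (simp add: algebra_simps)
      qed
      show "\<exists>d>0. \<forall>y. norm (y - x) < d \<longrightarrow>
          norm (integral {l..y} g - integral {l..x} g - (y - x) *\<^sub>R g x) \<le> e * norm (y - x)"
      proof (intro exI[of _ d] conjI allI impI)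
        fix y assume y: "norm (y - x) < d"
        consider "y = x" | "y > x" | "y < x" by linarith
        then show "norm (integral {l..y} g - integral {l..x} g - (y - x) *\<^sub>R g x) \<le> e * norm (y - x)"
        proof cases
          case 2
          have "norm (integral {x..x + (y - x)} k /\<^sub>R (y - x) - k x) < e"
            using 2 y d by (intro d1(2)) auto
          then have "norm (integral {x..y} k - (y - x) *\<^sub>R g x) \<le> e * (y - x)"
            using mult[of "y - x" "integral {x..y} k" "g x"] 2 kx by simp
          then show ?thesis using split[of x y] 2 y d lx by simp
        next
          case 3
          have "norm (integral {-x..-x + (x - y)} (\<lambda>x. k (-x)) /\<^sub>R (x - y) - k x) < e"
            using 3 y d by (intro d2(2)) auto
          moreover have "integral {-x..-x + (x - y)} (\<lambda>x. k (-x)) = integral {y..x} k"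
            using Henstock_Kurzweil_Integration.integral_reflect_real[of x y k] by simp
          ultimately have "norm (integral {y..x} k - (x - y) *\<^sub>R g x) \<le> e * (x - y)"
            using mult[of "x - y" "integral {y..x} k" "g x"] 3 kx by simp
          moreover have "integral {l..y} g - integral {l..x} g - (y - x) *\<^sub>R g x
              = - (integral {y..x} k - (x - y) *\<^sub>R g x)"
            using split[of y x] 3 y d lx by (simp add: algebra_simps)
          ultimately show ?thesis using 3 by (metis norm_minus_cancel abs_minus_commute abs_of_pos diff_gt_0_iff_gt real_norm_def)
        qed simp
      qed (fact d(1))
    qed (simp add: bounded_linear_scaleR_left)
  qed
qed

section \<open>The exponential and square integrable functions\<close>

lemma ee_0 [simp]: "ee 0 = 1"
  by (simp add: ee_def)

lemma ee_add: "ee (x + y) = ee x * ee y"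
  by (simp add: ee_def exp_add algebra_simps)

lemma ee_nonzero [simp]: "ee z \<noteq> 0"
  by (simp add: ee_def)

lemma ee_minus_cancel [simp]: "ee z * ee (- z) = 1" "ee (- z) * ee z = 1"
  by (simp_all flip: ee_add)

lemma ee_eq_1_iff: "ee z = 1 \<longleftrightarrow> (\<exists>n::int. z = of_int n)"
proof -
  have "ee z = 1 \<longleftrightarrow> Re (\<i> * 2 * pi * z) = 0 \<and> (\<exists>n::int. Im (\<i> * 2 * pi * z) = of_int (2 * n) * pi)"
    unfolding ee_def exp_eq_1 ..
  also have "\<dots> \<longleftrightarrow> Im z = 0 \<and> (\<exists>n::int. Re z = of_int n)"
    by simp
  also have "\<dots> \<longleftrightarrow> (\<exists>n::int. z = of_int n)"
    by (auto simp: complex_eq_iff)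
  finally show ?thesis .
qed

lemma ee_has_vector_derivative:
  "((\<lambda>x. ee (w * of_real x)) has_vector_derivative \<i> * 2 * pi * w * ee (w * of_real x)) (at x within A)"
  unfolding ee_def
  by (rule has_vector_derivative_real_field) (auto intro!: derivative_eq_intros)

lemma continuous_on_ee [continuous_intros]:
  "continuous_on A f \<Longrightarrow> continuous_on A (\<lambda>x. ee (f x))"
  unfolding ee_def by (intro continuous_intros)

lemma ee_bounded:
  obtains C where "C > 0" "\<And>x. x \<in> {a..b} \<Longrightarrow> norm (ee (w * of_real x)) \<le> C"
proof -
  have "compact ((\<lambda>x. ee (w * of_real x)) ` {a..b})"
    by (intro compact_continuous_image continuous_intros) auto
  then show ?thesis using that bounded_pos compact_imp_bounded by (metis imageI)
qed

text \<open>This weighted arithmetic-geometric mean inequality bounds an integral of \<open>norm y\<close> by the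
  measure of the domain and the integral of the square; the weight \<open>c\<close> is then chosen to suit. It
  plays the part of the Cauchy-Schwarz inequality below.\<close>
lemma norm_le_weighted_mean:
  fixes y :: "'a::real_normed_vector"
  assumes "c > 0"
  shows "norm y \<le> (c + (norm y)\<^sup>2 / c) / 2"
proof -
  have "0 \<le> (norm y - c)\<^sup>2" by simp
  then show ?thesis using assms by (simp add: power2_eq_square field_simps)
qed

lemma L2D:
  assumes "f \<in> L2 M"
  shows "f \<in> borel_measurable M" "integrable M (\<lambda>x. (norm (f x))\<^sup>2)"
  using assms by (auto simp: L2_def)

lemma L2_norm_nonneg [simp]: "0 \<le> L2_norm M f"
  by (simp add: L2_norm_def)

lemma L2_norm_power2: "(L2_norm M f)\<^sup>2 = (LINT x|M. (norm (f x))\<^sup>2)"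
  by (simp add: L2_norm_def)

lemma L2_add:
  assumes "f \<in> L2 M" "g \<in> L2 M"
  shows "(\<lambda>x. f x + g x) \<in> L2 M"
proof -
  note [measurable] = L2D(1)[OF assms(1)] L2D(1)[OF assms(2)]
  have "integrable M (\<lambda>x. (norm (f x + g x))\<^sup>2)"
  proof (rule Bochner_Integration.integrable_bound)
    show "integrable M (\<lambda>x. 2 * (norm (f x))\<^sup>2 + 2 * (norm (g x))\<^sup>2)"
      using assms L2D(2) by (intro Bochner_Integration.integrable_add integrable_mult_right) auto
    have "(norm (f x + g x))\<^sup>2 \<le> 2 * (norm (f x))\<^sup>2 + 2 * (norm (g x))\<^sup>2" for x
    proof -
      have "(norm (f x + g x))\<^sup>2 \<le> (norm (f x) + norm (g x))\<^sup>2"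
        by (intro power_mono norm_triangle_ineq) auto
      also have "\<dots> \<le> 2 * (norm (f x))\<^sup>2 + 2 * (norm (g x))\<^sup>2"
        using sum_squares_bound[of "norm (f x)" "norm (g x)"] by (simp add: power2_sum)
      finally show ?thesis .
    qed
    then show "AE x in M. norm ((norm (f x + g x))\<^sup>2) \<le> norm (2 * (norm (f x))\<^sup>2 + 2 * (norm (g x))\<^sup>2)"
      by simp
  qed simp
  then show ?thesis by (simp add: L2_def)
qed

lemma L2_mult_bounded:
  assumes "f \<in> L2 M" "k \<in> borel_measurable M" "\<And>x. x \<in> space M \<Longrightarrow> norm (k x) \<le> C"
  shows "(\<lambda>x. k x * f x) \<in> L2 M"
proof -
  note [measurable] = L2D(1)[OF assms(1)] assms(2)
  have "integrable M (\<lambda>x. (norm (k x * f x))\<^sup>2)"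
  proof (rule Bochner_Integration.integrable_bound)
    show "integrable M (\<lambda>x. C\<^sup>2 * (norm (f x))\<^sup>2)"
      using L2D(2)[OF assms(1)] by simp
    have "(norm (k x * f x))\<^sup>2 \<le> C\<^sup>2 * (norm (f x))\<^sup>2" if "x \<in> space M" for x
      unfolding norm_mult power_mult_distrib
      using assms(3)[OF that] by (intro mult_right_mono power_mono) auto
    then show "AE x in M. norm ((norm (k x * f x))\<^sup>2) \<le> norm (C\<^sup>2 * (norm (f x))\<^sup>2)"
      by simp
  qed simp
  then show ?thesis by (simp add: L2_def)
qed

lemma L2_const: "S \<in> lmeasurable \<Longrightarrow> (\<lambda>x. c) \<in> L2 (lebesgue_on S)"
  using finite_measure_lebesgue_on finite_measure.integrable_const unfolding L2_def by auto

lemma L2_continuous_on: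
  fixes S :: "real set"
  assumes "compact S" "continuous_on S f"
  shows "f \<in> L2 (lebesgue_on S)"
proof -
  have S: "S \<in> lmeasurable" using assms(1) by (rule lmeasurable_compact)
  obtain C where "\<And>x. x \<in> S \<Longrightarrow> norm (f x) \<le> C"
    using compact_imp_bounded[OF compact_continuous_image[OF assms(2,1)]] bounded_iff
    by (metis imageI)
  then have "(\<lambda>x. f x * 1) \<in> L2 (lebesgue_on S)"
    by (intro L2_mult_bounded[where C = C] L2_const[OF S] continuous_imp_measurable_on_sets_lebesgue
        assms fmeasurableD[OF S]) auto
  then show ?thesis by simp
qed

lemma L2_lebesgue_on_subset:
  assumes "f \<in> L2 (lebesgue_on S)" "T \<subseteq> S" "T \<in> sets lebesgue" "S \<in> sets lebesgue"
  shows "f \<in> L2 (lebesgue_on T)"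
proof -
  have "f \<in> borel_measurable (lebesgue_on T)"
    using L2D(1)[OF assms(1)] assms(2) measurable_restrict_mono by blast
  moreover have "integrable (lebesgue_on T) (\<lambda>x. (norm (f x))\<^sup>2)"
  proof -
    have "set_integrable lebesgue S (\<lambda>x. (norm (f x))\<^sup>2)"
      using L2D(2)[OF assms(1)] assms(4) by (simp add: set_integrable_def integrable_restrict_space)
    then have "set_integrable lebesgue T (\<lambda>x. (norm (f x))\<^sup>2)"
      using assms(2,3) set_integrable_subset by blast
    then show ?thesis using assms(3) by (simp add: set_integrable_def integrable_restrict_space)
  qed
  ultimately show ?thesis by (simp add: L2_def)
qed

lemma L2_imp_integrable:
  assumes "f \<in> L2 (lebesgue_on S)" "S \<in> lmeasurable"
  shows "integrable (lebesgue_on S) f"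
proof (rule Bochner_Integration.integrable_bound)
  show "integrable (lebesgue_on S) (\<lambda>x. (1 + (norm (f x))\<^sup>2 / 1) / 2)"
    using L2D(2)[OF assms(1)] finite_measure.integrable_const[OF finite_measure_lebesgue_on[OF assms(2)]]
    by (intro integrable_divide Bochner_Integration.integrable_add) auto
  show "AE x in lebesgue_on S. norm (f x) \<le> norm ((1 + (norm (f x))\<^sup>2 / 1) / 2)"
    using norm_le_weighted_mean[of 1 "f _"] by (intro AE_I2) (metis abs_ge_self order_trans real_norm_def zero_less_one)
qed (rule L2D(1)[OF assms(1)])

lemma L2_cong_AE:
  fixes f g :: "real \<Rightarrow> complex"
  assumes f: "f \<in> L2 (lebesgue_on S)" and S: "S \<in> sets lebesgue"
    and eq: "AE x in lebesgue_on S. g x = f x"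
  shows "g \<in> L2 (lebesgue_on S)"
proof -
  have "negligible {x \<in> S. g x \<noteq> f x}"
    using eq unfolding AE_lebesgue_on_iff_negligible[OF S] .
  moreover have "f measurable_on S"
    using measurable_on_iff_borel_measurable[OF S] L2D(1)[OF f] by (rule iffD2)
  ultimately have "g measurable_on S"
    by (intro measurable_on_spike[of f S "{x \<in> S. g x \<noteq> f x}" g]) simp_all
  with measurable_on_iff_borel_measurable[OF S] have g: "g \<in> borel_measurable (lebesgue_on S)"
    by (rule iffD1)
  note [measurable] = g L2D(1)[OF f]
  have "integrable (lebesgue_on S) (\<lambda>x. (norm (g x))\<^sup>2)"
  proof (rule integrable_cong_AE_imp[OF L2D(2)[OF f]])
    show "AE x in lebesgue_on S. (norm (f x))\<^sup>2 = (norm (g x))\<^sup>2"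
      using eq by (rule eventually_mono) simp
  qed simp
  with g show ?thesis by (simp add: L2_def)
qed

text \<open>The weight \<open>c = L2_norm h\<close> in the inequality above would suffice if it were positive;
  the proof uses a slightly larger one and lets it tend to the norm.\<close>
lemma norm_integral_le_L2_norm:
  fixes h k :: "real \<Rightarrow> complex"
  assumes h: "h \<in> L2 (lebesgue_on S)" and S: "S \<in> lmeasurable" "{u..v} \<subseteq> S"
    and k: "k \<in> borel_measurable (lebesgue_on S)" "\<And>x. x \<in> S \<Longrightarrow> norm (k x) \<le> C"
  shows "norm (integral {u..v} (\<lambda>t. k t * h t)) \<le> C * (measure lebesgue S + 1) / 2 * L2_norm (lebesgue_on S) h"
proof (cases "S = {}")
  case True
  then show ?thesis using S(2) by (auto simp: L2_norm_def)
next
  case False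
  then have C: "C \<ge> 0" using k(2) norm_ge_zero order_trans by (metis ex_in_conv)
  have Sl: "S \<in> sets lebesgue" using S(1) by (rule fmeasurableD)
  have kh: "(\<lambda>t. k t * h t) \<in> L2 (lebesgue_on S)"
    using L2_mult_bounded[OF h k(1)] k(2) by auto
  have int: "integrable (lebesgue_on S) h" "integrable (lebesgue_on S) (\<lambda>t. k t * h t)"
    using L2_imp_integrable[OF h S(1)] L2_imp_integrable[OF kh S(1)] by auto
  define H where "H = L2_norm (lebesgue_on S) h"
  have H: "H \<ge> 0" "(LINT x|lebesgue_on S. (norm (h x))\<^sup>2) = H\<^sup>2"
    by (simp_all add: H_def L2_norm_power2)
  have abs_int: "(\<lambda>t. C * norm (h t)) integrable_on S"
    using int(1) by (intro integrable_on_lebesgue_on[OF _ Sl]) auto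
  have "norm (integral {u..v} (\<lambda>t. k t * h t)) \<le> integral {u..v} (\<lambda>t. C * norm (h t))"
  proof (rule Henstock_Kurzweil_Integration.integral_norm_bound_integral)
    show "(\<lambda>t. k t * h t) integrable_on {u..v}"
      using integrable_on_lebesgue_on[OF int(2) Sl] S(2) by (rule integrable_on_subinterval)
    show "(\<lambda>t. C * norm (h t)) integrable_on {u..v}"
      using abs_int S(2) by (rule integrable_on_subinterval)
    show "norm (k t * h t) \<le> C * norm (h t)" if "t \<in> {u..v}" for t
      unfolding norm_mult using that S(2) k(2) by (intro mult_right_mono) auto
  qed
  also have "\<dots> \<le> integral S (\<lambda>t. C * norm (h t))"
    using abs_int S(2) C by (intro integral_subset_le integrable_on_subinterval[OF abs_int]) auto
  also have "\<dots> = C * (LINT x|lebesgue_on S. norm (h x))"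
  proof -
    have "integrable (lebesgue_on S) (\<lambda>t. C * norm (h t))" using int(1) by simp
    from lebesgue_integral_eq_integral[OF this Sl, symmetric] show ?thesis
      by (simp only: integral_mult_right_zero)
  qed
  also have "\<dots> \<le> C * ((measure lebesgue S + 1) / 2 * H)"
  proof (rule mult_left_mono[OF _ C], rule field_le_epsilon)
    fix e :: real assume "e > 0"
    define m where "m = measure lebesgue S"
    have m: "m \<ge> 0" by (simp add: m_def)
    define c where "c = H + 2 * e / (m + 1)"
    have c: "c > 0" "H \<le> c" using H \<open>e > 0\<close> m by (simp_all add: c_def add_nonneg_pos)
    have "(LINT x|lebesgue_on S. norm (h x)) \<le> (LINT x|lebesgue_on S. (c + (norm (h x))\<^sup>2 / c) / 2)"
      using int(1) L2D(2)[OF h] finite_measure.integrable_const[OF finite_measure_lebesgue_on[OF S(1)]]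
      by (intro integral_mono norm_le_weighted_mean c integrable_divide Bochner_Integration.integrable_add) auto
    also have "\<dots> = (c * m + H\<^sup>2 / c) / 2"
      using L2D(2)[OF h] finite_measure.integrable_const[OF finite_measure_lebesgue_on[OF S(1)], of c]
      by (simp add: H(2) m_def measure_restrict_space Sl)
    also have "\<dots> \<le> (c * m + c) / 2"
    proof -
      have "H\<^sup>2 \<le> c * c" using c H by (simp add: power2_eq_square mult_mono)
      then show ?thesis using c by (simp add: divide_le_eq)
    qed
    also have "\<dots> = (m + 1) / 2 * H + e"
    proof -
      have "c * (m + 1) = H * (m + 1) + 2 * e"
        using m by (simp add: c_def distrib_right add_nonneg_eq_0_iff)
      then show ?thesis by (simp add: algebra_simps add_divide_distrib)
    qed
    finally show "(LINT x|lebesgue_on S. norm (h x)) \<le> (measure lebesgue S + 1) / 2 * H + e"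
      by (simp add: m_def)
  qed
  finally show ?thesis by (simp add: H_def algebra_simps)
qed

text \<open>Over a division, the weighted mean inequality bounds the sum of the increments by
  \<open>(c m + G / c) / 2\<close>, where \<open>m\<close> is the total length and \<open>G\<close> the integral of
  the square of \<open>g\<close>. Choose \<open>c\<close> large, and then \<open>m\<close> small.\<close>
lemma abs_continuous_on_indefinite_integral:
  assumes g: "g \<in> L2 (lebesgue_on {l..r})"
    and f: "\<And>u v. l \<le> u \<Longrightarrow> u \<le> v \<Longrightarrow> v \<le> r \<Longrightarrow> f v - f u = integral {u..v} g"
  shows "abs_continuous_on {l..r} f"
  unfolding abs_continuous_on_def
proof (intro allI impI)
  fix \<epsilon> :: real assume "\<epsilon> > 0"
  define q where "q = (\<lambda>x. (norm (g x))\<^sup>2)"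
  have int: "integrable (lebesgue_on {l..r}) g" "integrable (lebesgue_on {l..r}) q"
    using L2_imp_integrable[OF g] L2D(2)[OF g] by (auto simp: q_def)
  have hk: "g integrable_on {l..r}" "(\<lambda>x. norm (g x)) integrable_on {l..r}" "q integrable_on {l..r}"
    using int by (auto intro!: integrable_on_lebesgue_on)
  define G where "G = integral {l..r} q"
  have G: "G \<ge> 0" unfolding G_def by (rule integral_nonneg[OF hk(3)]) (simp add: q_def)
  \<comment> \<open>Makes \<open>G / c\<close> at most \<open>\<epsilon>\<close> also when \<open>G = 0\<close>.\<close>
  define c where "c = G / \<epsilon> + 1"
  have c: "c > 0" "G / c \<le> \<epsilon>"
    using G \<open>\<epsilon> > 0\<close> by (simp_all add: c_def add_nonneg_pos field_simps)
  show "\<exists>\<delta>>0. \<forall>\<D> t. \<D> division_of t \<and> t \<subseteq> {l..r} \<and> (\<Sum>K\<in>\<D>. measure lborel K) < \<delta> \<longrightarrow>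
      (\<Sum>K\<in>\<D>. norm (f (Sup K) - f (Inf K))) < \<epsilon>"
  proof (intro exI[of _ "\<epsilon> / c"] conjI allI impI)
    fix \<D> t assume "\<D> division_of t \<and> t \<subseteq> {l..r} \<and> (\<Sum>K\<in>\<D>. measure lborel K) < \<epsilon> / c"
    then have div: "\<D> division_of t" and t: "t \<subseteq> {l..r}"
      and small: "(\<Sum>K\<in>\<D>. measure lborel K) < \<epsilon> / c" by auto
    have "(\<Sum>K\<in>\<D>. norm (f (Sup K) - f (Inf K))) \<le> (\<Sum>K\<in>\<D>. (c * measure lborel K + integral K q / c) / 2)"
    proof (rule sum_mono)
      fix K assume "K \<in> \<D>"
      obtain u v where K: "K = {u..v}" "u \<le> v" "{u..v} \<subseteq> t" "Inf K = u" "Sup K = v"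
          "measure lborel K = v - u"
        by (rule division_realE[OF div \<open>K \<in> \<D>\<close>])
      have sub: "{u..v} \<subseteq> {l..r}" using K(3) t by blast
      then have uv: "l \<le> u" "v \<le> r" using K(2) by auto
      have q_uv: "q integrable_on {u..v}" using hk(3) sub by (rule integrable_on_subinterval)
      have "norm (f v - f u) = norm (integral {u..v} g)" using f uv K(2) by simp
      also have "\<dots> \<le> integral {u..v} (\<lambda>x. (c + q x / c) / 2)"
      proof (rule Henstock_Kurzweil_Integration.integral_norm_bound_integral)
        show "g integrable_on {u..v}" using hk(1) sub by (rule integrable_on_subinterval)
        show "(\<lambda>x. (c + q x / c) / 2) integrable_on {u..v}"
          using q_uv by (intro integrable_on_divide integrable_add integrable_const_ivl)
        show "norm (g x) \<le> (c + q x / c) / 2" for x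
          unfolding q_def by (rule norm_le_weighted_mean[OF c(1)])
      qed
      also have "\<dots> = (c * (v - u) + integral {u..v} q / c) / 2"
        using q_uv K(2) by (simp add: Henstock_Kurzweil_Integration.integral_add integrable_on_divide integrable_const_ivl)
      finally show "norm (f (Sup K) - f (Inf K)) \<le> (c * measure lborel K + integral K q / c) / 2"
        using K by simp
    qed
    also have "\<dots> = (c * (\<Sum>K\<in>\<D>. measure lborel K) + (\<Sum>K\<in>\<D>. integral K q) / c) / 2"
      by (simp add: sum.distrib sum_distrib_left sum_divide_distrib add_divide_distrib)
    also have "(\<Sum>K\<in>\<D>. integral K q) = integral t q"
      using has_integral_combine_division_topdown[OF hk(3) div t] by (simp add: integral_unique)
    also have "integral t q \<le> G"
      unfolding G_def using has_integral_combine_division_topdown[OF hk(3) div t] hk(3) t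
      by (intro integral_subset_le) (auto simp: q_def integrable_on_def)
    then have "(c * (\<Sum>K\<in>\<D>. measure lborel K) + integral t q / c) / 2
        \<le> (c * (\<Sum>K\<in>\<D>. measure lborel K) + G / c) / 2"
      using c(1) by (simp add: divide_right_mono)
    also have "\<dots> < \<epsilon>"
    proof -
      have "c * (\<Sum>K\<in>\<D>. measure lborel K) < \<epsilon>"
        using small c(1) by (simp add: pos_less_divide_eq mult.commute)
      then show ?thesis using c(2) by simp
    qed
    finally show "(\<Sum>K\<in>\<D>. norm (f (Sup K) - f (Inf K))) < \<epsilon>" by simp
  qed (use c \<open>\<epsilon> > 0\<close> in simp)
qed

lemma abs_continuous_on_C1:
  assumes der: "\<And>x. x \<in> {l..r} \<Longrightarrow> (f has_vector_derivative f' x) (at x within {l..r})"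
    and cont: "continuous_on {l..r} f'"
  shows "abs_continuous_on {l..r} f"
proof (rule abs_continuous_on_indefinite_integral)
  show "f' \<in> L2 (lebesgue_on {l..r})"
    using cont by (rule L2_continuous_on[OF compact_Icc])
  fix u v assume "l \<le> u" "u \<le> v" "v \<le> r"
  then have "(f' has_integral f v - f u) {u..v}"
    by (intro fundamental_theorem_of_calculus has_vector_derivative_within_subset[OF der]) auto
  then show "f v - f u = integral {u..v} f'" by (simp add: integral_unique)
qed

lemma abs_continuous_on_ee: "abs_continuous_on {l..r} (\<lambda>x. ee (w * of_real x))"
  by (rule abs_continuous_on_C1[OF ee_has_vector_derivative]) (intro continuous_intros)

section \<open>The resolvent equation\<close>

text \<open>In the product \<open>e (- z t) f t\<close>, which is again absolutely continuous, the terms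
  with \<open>z\<close> cancel upon differentiation; integrate its derivative
  \<open>i 2 \<pi> e (- z t) h t\<close>.\<close>
lemma duhamel_formula:
  assumes ac: "abs_continuous_on {l..r} f"
    and der: "AE x in lebesgue_on {l..r}. (f has_vector_derivative \<i> * 2 * pi * (z * f x + h x)) (at x)"
    and x: "x \<in> {l..r}"
  shows "f x = ee (z * of_real x) * (ee (- z * of_real l) * f l
           + \<i> * 2 * pi * integral {l..x} (\<lambda>t. ee (- z * of_real t) * h t))"
proof -
  define N where "N = {t \<in> {l..r}. \<not> (f has_vector_derivative \<i> * 2 * pi * (z * f t + h t)) (at t)}"
  have N: "negligible N"
    using der unfolding N_def by (subst (asm) AE_lebesgue_on_iff_negligible) simp_all
  have sub: "{l..x} \<subseteq> {l..r}" using x by auto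
  have "((\<lambda>t. \<i> * 2 * pi * (ee (- z * of_real t) * h t)) has_integral
      ee (- z * of_real x) * f x - ee (- z * of_real l) * f l) {l..x}"
  proof (rule abs_continuous_on_has_integral_derivative[OF _ _ N])
    show "l \<le> x" using x by simp
    show "abs_continuous_on {l..x} (\<lambda>t. ee (- z * of_real t) * f t)"
      by (rule abs_continuous_on_mult_interval[OF abs_continuous_on_ee abs_continuous_on_subset[OF ac sub]])
    fix t assume "t \<in> {l..x} - N"
    then have "(f has_vector_derivative \<i> * 2 * pi * (z * f t + h t)) (at t)"
      using sub by (auto simp: N_def)
    then have "(f has_vector_derivative \<i> * 2 * pi * (z * f t + h t)) (at t within {l..x})"
      by (rule has_vector_derivative_at_within)
    from has_vector_derivative_mult[OF ee_has_vector_derivative[of "- z"] this]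
    show "((\<lambda>t. ee (- z * of_real t) * f t) has_vector_derivative
        \<i> * 2 * pi * (ee (- z * of_real t) * h t)) (at t within {l..x})"
      by (simp add: algebra_simps)
  qed
  then have "\<i> * 2 * pi * integral {l..x} (\<lambda>t. ee (- z * of_real t) * h t)
      = ee (- z * of_real x) * f x - ee (- z * of_real l) * f l"
    by (subst Henstock_Kurzweil_Integration.integral_mult_right[symmetric]) (rule integral_unique)
  then have "ee (z * of_real x) * (ee (- z * of_real l) * f l
      + \<i> * 2 * pi * integral {l..x} (\<lambda>t. ee (- z * of_real t) * h t))
      = (ee (z * of_real x) * ee (- (z * of_real x))) * f x"
    by simp
  then show ?thesis by simp
qed

text \<open>The converse: differentiate the product of the exponential with the indefinite integral. The end
  points are excluded from the differentiation, because \<open>f\<close> is arbitrary outside the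
  interval.\<close>
lemma duhamel_solves:
  assumes h: "h \<in> L2 (lebesgue_on {l..r})"
    and f: "\<And>x. x \<in> {l..r} \<Longrightarrow> f x = ee (z * of_real x) *
           (c + \<i> * 2 * pi * integral {l..x} (\<lambda>t. ee (- z * of_real t) * h t))"
  shows "abs_continuous_on {l..r} f"
    and "AE x in lebesgue_on {l..r}. (f has_vector_derivative \<i> * 2 * pi * (z * f x + h x)) (at x)"
proof -
  define k where "k = (\<lambda>t. ee (- z * of_real t) * h t)"
  define v where "v = (\<lambda>x. c + \<i> * 2 * pi * integral {l..x} k)"
  obtain C where C: "\<And>x. x \<in> {l..r} \<Longrightarrow> norm (ee (- z * of_real x)) \<le> C"
    using ee_bounded[of l r "- z"] by metis
  have k: "k \<in> L2 (lebesgue_on {l..r})"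
    unfolding k_def
    by (rule L2_mult_bounded[OF h, where C = C])
       (use C in \<open>auto intro!: continuous_imp_measurable_on_sets_lebesgue continuous_intros\<close>)
  have k': "(\<lambda>t. \<i> * 2 * pi * k t) \<in> L2 (lebesgue_on {l..r})"
    by (rule L2_mult_bounded[OF k, where C = "norm (\<i> * 2 * pi)"]) auto
  have k_int: "k integrable_on {l..r}"
    by (rule integrable_on_lebesgue_on[OF L2_imp_integrable[OF k]]) auto
  have "abs_continuous_on {l..r} v"
  proof (rule abs_continuous_on_indefinite_integral[OF k'])
    fix x y assume xy: "l \<le> x" "x \<le> y" "y \<le> r"
    then have "k integrable_on {l..y}" by (intro integrable_on_subinterval[OF k_int]) auto
    then have "integral {l..x} k + integral {x..y} k = integral {l..y} k"
      using xy by (intro Henstock_Kurzweil_Integration.integral_combine) auto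
    then show "v y - v x = integral {x..y} (\<lambda>t. \<i> * 2 * pi * k t)"
      by (simp add: v_def algebra_simps flip: distrib_left)
  qed
  from abs_continuous_on_mult_interval[OF abs_continuous_on_ee[of _ _ z] this]
  show "abs_continuous_on {l..r} f"
    by (rule abs_continuous_on_cong) (simp add: f v_def k_def)
  obtain N where N: "negligible N"
    "\<And>x. x \<in> {l<..<r} - N \<Longrightarrow> ((\<lambda>x. integral {l..x} k) has_vector_derivative k x) (at x)"
    by (rule indefinite_integral_has_vector_derivative_ae[OF k_int]) blast
  have deriv: "(f has_vector_derivative \<i> * 2 * pi * (z * f x + h x)) (at x)" if x: "x \<in> {l<..<r} - N" for x
  proof (rule has_vector_derivative_transform_within_open[of _ _ _ "{l<..<r}"])
    have "(v has_vector_derivative \<i> * 2 * pi * k x) (at x)"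
      unfolding v_def
      using has_vector_derivative_add[OF has_vector_derivative_const
          has_vector_derivative_mult_right[OF N(2)[OF x], of "\<i> * 2 * pi"], of c]
      by simp
    from has_vector_derivative_mult[OF ee_has_vector_derivative[of z] this]
    have "((\<lambda>x. ee (z * of_real x) * v x) has_vector_derivative
        ee (z * of_real x) * (\<i> * 2 * pi * k x) + \<i> * 2 * pi * z * ee (z * of_real x) * v x) (at x)" .
    moreover have fx: "f x = ee (z * of_real x) * v x" using f[of x] x by (simp add: v_def k_def)
    moreover have hx: "h x = ee (z * of_real x) * k x" by (simp add: k_def flip: mult.assoc)
    ultimately show "((\<lambda>x. ee (z * of_real x) * v x) has_vector_derivative
        \<i> * 2 * pi * (z * f x + h x)) (at x)"
      unfolding fx hx by (simp add: algebra_simps)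
    show "ee (z * of_real y) * v y = f y" if "y \<in> {l<..<r}" for y
      using f[of y] that by (simp add: v_def k_def)
  qed (use x in auto)
  have "{x \<in> {l..r}. \<not> (f has_vector_derivative \<i> * 2 * pi * (z * f x + h x)) (at x)} \<subseteq> insert l (insert r N)"
  proof (rule subsetI, rule ccontr)
    fix x assume x: "x \<in> {x \<in> {l..r}. \<not> (f has_vector_derivative \<i> * 2 * pi * (z * f x + h x)) (at x)}"
      and "x \<notin> insert l (insert r N)"
    then have "x \<in> {l<..<r} - N" by auto
    from deriv[OF this] x show False by simp
  qed
  then have "negligible {x \<in> {l..r}. \<not> (f has_vector_derivative \<i> * 2 * pi * (z * f x + h x)) (at x)}"
    by (rule negligible_subset[rotated]) (simp add: N(1))
  then show "AE x in lebesgue_on {l..r}. (f has_vector_derivative \<i> * 2 * pi * (z * f x + h x)) (at x)"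
    by (subst AE_lebesgue_on_iff_negligible) simp_all
qed

lemma two_intervals_lmeasurable: "two_intervals \<alpha> \<beta> \<in> lmeasurable"
  by (simp add: two_intervals_def fmeasurable.Un)

lemma compact_two_intervals: "compact (two_intervals \<alpha> \<beta>)"
  by (simp add: two_intervals_def compact_Un)

lemma abs_continuous_on_two_intervals_imp_continuous_on:
  assumes "abs_continuous_on (two_intervals \<alpha> \<beta>) f"
  shows "continuous_on (two_intervals \<alpha> \<beta>) f"
proof -
  have "continuous_on {0..1} f" "continuous_on {\<alpha>..\<beta>} f"
    by (rule abs_continuous_on_imp_continuous_on, rule abs_continuous_on_subset[OF assms],
        simp add: two_intervals_def)+
  then show ?thesis
    unfolding two_intervals_def by (intro continuous_on_closed_Un) auto
qed

lemma momentum_op_eq_iff: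
  assumes "(f has_vector_derivative d) (at x)"
  shows "momentum_op f x - z * f x = h x \<longleftrightarrow>
    (f has_vector_derivative \<i> * 2 * pi * (z * f x + h x)) (at x)"
proof -
  have d: "vector_derivative f (at x) = d" using assms by (rule vector_derivative_at)
  have "momentum_op f x - z * f x = h x \<longleftrightarrow> d / (\<i> * 2 * pi) = z * f x + h x"
    by (simp add: momentum_op_def d algebra_simps)
  also have "\<dots> \<longleftrightarrow> d = \<i> * 2 * pi * (z * f x + h x)"
    by (auto simp: field_simps)
  also have "\<dots> \<longleftrightarrow> (f has_vector_derivative \<i> * 2 * pi * (z * f x + h x)) (at x)"
    using assms vector_derivative_at by metis
  finally show ?thesis .
qed

lemma P_domain_ae_differentiable:
  assumes "f \<in> P_domain \<alpha> \<beta>"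
  shows "AE x in lebesgue_on (two_intervals \<alpha> \<beta>). \<exists>d. (f has_vector_derivative d) (at x)"
proof -
  obtain g where "AE x in lebesgue_on (two_intervals \<alpha> \<beta>). (f has_vector_derivative g x) (at x)"
    using assms by (auto simp: P_domain_def)
  then show ?thesis by (rule eventually_mono) auto
qed

text \<open>The equation \<open>P f - z f = h\<close> solved for the derivative. It avoids
  \<open>vector_derivative\<close>, which carries no information at points where \<open>f\<close> is not
  differentiable, and makes sense on any set, so that the two intervals can be treated one at a
  time.\<close>
definition resolvent_eq :: "real set \<Rightarrow> complex \<Rightarrow> (real \<Rightarrow> complex) \<Rightarrow> (real \<Rightarrow> complex) \<Rightarrow> bool" where
  "resolvent_eq S z h f \<longleftrightarrow> abs_continuous_on S f \<and>
     (AE x in lebesgue_on S. (f has_vector_derivative \<i> * 2 * pi * (z * f x + h x)) (at x))"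

text \<open>The derivative of a solution is square integrable, because \<open>h\<close> is, and because
  \<open>f\<close> is continuous on a compact set.\<close>
lemma resolvent_eq_iff_P_domain:
  assumes "h \<in> L2 (lebesgue_on (two_intervals \<alpha> \<beta>))"
  shows "resolvent_eq (two_intervals \<alpha> \<beta>) z h f \<longleftrightarrow>
    f \<in> P_domain \<alpha> \<beta> \<and> (AE x in lebesgue_on (two_intervals \<alpha> \<beta>). momentum_op f x - z * f x = h x)"
proof
  assume "f \<in> P_domain \<alpha> \<beta> \<and> (AE x in lebesgue_on (two_intervals \<alpha> \<beta>). momentum_op f x - z * f x = h x)"
  then have f: "f \<in> P_domain \<alpha> \<beta>"
    and eq: "AE x in lebesgue_on (two_intervals \<alpha> \<beta>). momentum_op f x - z * f x = h x" by auto
  have "AE x in lebesgue_on (two_intervals \<alpha> \<beta>). (f has_vector_derivative \<i> * 2 * pi * (z * f x + h x)) (at x)"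
    using eq P_domain_ae_differentiable[OF f]
  proof eventually_elim
    case (elim x)
    then show ?case using momentum_op_eq_iff by blast
  qed
  then show "resolvent_eq (two_intervals \<alpha> \<beta>) z h f"
    using f by (simp add: resolvent_eq_def P_domain_def)
next
  assume "resolvent_eq (two_intervals \<alpha> \<beta>) z h f"
  then have ac: "abs_continuous_on (two_intervals \<alpha> \<beta>) f"
    and der: "AE x in lebesgue_on (two_intervals \<alpha> \<beta>). (f has_vector_derivative \<i> * 2 * pi * (z * f x + h x)) (at x)"
    by (auto simp: resolvent_eq_def)
  have "continuous_on (two_intervals \<alpha> \<beta>) f"
    by (rule abs_continuous_on_two_intervals_imp_continuous_on[OF ac])
  then have "(\<lambda>x. \<i> * 2 * pi * z * f x) \<in> L2 (lebesgue_on (two_intervals \<alpha> \<beta>))"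
    by (intro L2_continuous_on compact_two_intervals continuous_intros)
  moreover have "(\<lambda>x. \<i> * 2 * pi * h x) \<in> L2 (lebesgue_on (two_intervals \<alpha> \<beta>))"
    by (rule L2_mult_bounded[OF assms, where C = "norm (\<i> * 2 * pi)"]) auto
  ultimately have "(\<lambda>x. \<i> * 2 * pi * z * f x + \<i> * 2 * pi * h x) \<in> L2 (lebesgue_on (two_intervals \<alpha> \<beta>))"
    by (rule L2_add)
  then have "(\<lambda>x. \<i> * 2 * pi * (z * f x + h x)) \<in> L2 (lebesgue_on (two_intervals \<alpha> \<beta>))"
    by (simp add: distrib_left mult.assoc)
  then have "f \<in> P_domain \<alpha> \<beta>" using ac der by (auto simp: P_domain_def)
  moreover have "AE x in lebesgue_on (two_intervals \<alpha> \<beta>). momentum_op f x - z * f x = h x"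
    using der by (rule eventually_mono) (use momentum_op_eq_iff in blast)
  ultimately show "f \<in> P_domain \<alpha> \<beta> \<and> (AE x in lebesgue_on (two_intervals \<alpha> \<beta>). momentum_op f x - z * f x = h x)"
    by blast
qed

lemma resolvent_eq_two_intervals:
  assumes "1 < \<alpha>"
  shows "resolvent_eq (two_intervals \<alpha> \<beta>) z h f \<longleftrightarrow> resolvent_eq {0..1} z h f \<and> resolvent_eq {\<alpha>..\<beta>} z h f"
proof -
  let ?bad = "\<lambda>S. {x \<in> S. \<not> (f has_vector_derivative \<i> * 2 * pi * (z * f x + h x)) (at x)}"
  have "?bad (two_intervals \<alpha> \<beta>) = ?bad {0..1} \<union> ?bad {\<alpha>..\<beta>}" by (auto simp: two_intervals_def)
  then have "negligible (?bad (two_intervals \<alpha> \<beta>)) \<longleftrightarrow> negligible (?bad {0..1}) \<and> negligible (?bad {\<alpha>..\<beta>})"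
    by (simp only: negligible_Un_eq)
  moreover have "abs_continuous_on (two_intervals \<alpha> \<beta>) f \<longleftrightarrow>
      abs_continuous_on {0..1} f \<and> abs_continuous_on {\<alpha>..\<beta>} f"
    using abs_continuous_on_two_intervals[OF assms, of f \<beta>]
      abs_continuous_on_subset[of "two_intervals \<alpha> \<beta>" f "{0..1}"]
      abs_continuous_on_subset[of "two_intervals \<alpha> \<beta>" f "{\<alpha>..\<beta>}"]
    unfolding two_intervals_def by blast
  ultimately show ?thesis
    unfolding resolvent_eq_def AE_lebesgue_on_iff_negligible[OF fmeasurableD[OF two_intervals_lmeasurable]]
      AE_lebesgue_on_iff_negligible[OF lmeasurable_cbox[THEN fmeasurableD], unfolded box_real]
    by blast
qed

lemma resolvent_eq_interval_iff:
  assumes h: "h \<in> L2 (lebesgue_on {l..r})"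
  shows "resolvent_eq {l..r} z h f \<longleftrightarrow> (\<forall>x\<in>{l..r}. f x = ee (z * of_real x) * (ee (- z * of_real l) * f l
           + \<i> * 2 * pi * integral {l..x} (\<lambda>t. ee (- z * of_real t) * h t)))"
proof
  assume "resolvent_eq {l..r} z h f"
  then have "abs_continuous_on {l..r} f"
    "AE x in lebesgue_on {l..r}. (f has_vector_derivative \<i> * 2 * pi * (z * f x + h x)) (at x)"
    by (auto simp: resolvent_eq_def)
  from duhamel_formula[OF this] show "\<forall>x\<in>{l..r}. f x = ee (z * of_real x) * (ee (- z * of_real l) * f l
           + \<i> * 2 * pi * integral {l..x} (\<lambda>t. ee (- z * of_real t) * h t))"
    by blast
next
  assume "\<forall>x\<in>{l..r}. f x = ee (z * of_real x) * (ee (- z * of_real l) * f l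
           + \<i> * 2 * pi * integral {l..x} (\<lambda>t. ee (- z * of_real t) * h t))"
  then have "f x = ee (z * of_real x) * (ee (- z * of_real l) * f l
           + \<i> * 2 * pi * integral {l..x} (\<lambda>t. ee (- z * of_real t) * h t))" if "x \<in> {l..r}" for x
    using that by blast
  from duhamel_solves[OF h this] show "resolvent_eq {l..r} z h f"
    by (simp add: resolvent_eq_def)
qed

text \<open>The function \<open>momentum_op f\<close> is known only almost everywhere, so its measurability rests
  on the completeness of Lebesgue measure.\<close>
lemma momentum_op_minus_in_L2:
  assumes "f \<in> P_domain \<alpha> \<beta>"
  shows "(\<lambda>x. momentum_op f x - z * f x) \<in> L2 (lebesgue_on (two_intervals \<alpha> \<beta>))"
proof -
  obtain g where g: "g \<in> L2 (lebesgue_on (two_intervals \<alpha> \<beta>))"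
    "AE x in lebesgue_on (two_intervals \<alpha> \<beta>). (f has_vector_derivative g x) (at x)"
    using assms by (auto simp: P_domain_def)
  have "(\<lambda>x. 1 / (\<i> * 2 * pi) * g x) \<in> L2 (lebesgue_on (two_intervals \<alpha> \<beta>))"
    by (rule L2_mult_bounded[OF g(1), where C = "norm (1 / (\<i> * 2 * pi))"]) auto
  moreover have "(\<lambda>x. - z * f x) \<in> L2 (lebesgue_on (two_intervals \<alpha> \<beta>))"
    using assms by (intro L2_continuous_on compact_two_intervals continuous_intros abs_continuous_on_two_intervals_imp_continuous_on)
      (simp add: P_domain_def)
  ultimately have "(\<lambda>x. 1 / (\<i> * 2 * pi) * g x + (- z * f x)) \<in> L2 (lebesgue_on (two_intervals \<alpha> \<beta>))"
    by (rule L2_add)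
  then show ?thesis
  proof (rule L2_cong_AE[OF _ fmeasurableD[OF two_intervals_lmeasurable]])
    show "AE x in lebesgue_on (two_intervals \<alpha> \<beta>).
        momentum_op f x - z * f x = 1 / (\<i> * 2 * pi) * g x + (- z * f x)"
      using g(2) by (rule eventually_mono) (simp add: momentum_op_def vector_derivative_at)
  qed
qed

section \<open>The boundary condition as a linear system\<close>

text \<open>The matrix that takes the values at the left end points \<open>0\<close> and \<open>\<alpha>\<close> of a
  solution with \<open>h = 0\<close> to its values at the right end points \<open>1\<close> and
  \<open>\<beta>\<close>.\<close>
definition propagator :: "real \<Rightarrow> real \<Rightarrow> complex \<Rightarrow> complex^2^2" where
  "propagator \<alpha> \<beta> z = vector [vector [ee z, 0], vector [0, ee (z * of_real (\<beta> - \<alpha>))]]"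

text \<open>The solution on an interval starting at \<open>l\<close> that vanishes at \<open>l\<close>.\<close>
definition forcing :: "complex \<Rightarrow> (real \<Rightarrow> complex) \<Rightarrow> real \<Rightarrow> real \<Rightarrow> complex" where
  "forcing z h l x = ee (z * of_real x) * (\<i> * 2 * pi * integral {l..x} (\<lambda>t. ee (- z * of_real t) * h t))"

text \<open>Duhamel's formula on both intervals: solutions correspond to their values at the two left end
  points.\<close>
lemma resolvent_eq_iff_propagated:
  assumes h: "h \<in> L2 (lebesgue_on (two_intervals \<alpha> \<beta>))" and \<alpha>: "1 < \<alpha>" "\<alpha> < \<beta>"
  shows "resolvent_eq (two_intervals \<alpha> \<beta>) z h f \<longleftrightarrow>
     (\<forall>x\<in>{0..1}. f x = ee (z * of_real x) * f 0 + forcing z h 0 x) \<and>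
     (\<forall>x\<in>{\<alpha>..\<beta>}. f x = ee (z * of_real (x - \<alpha>)) * f \<alpha> + forcing z h \<alpha> x)"
proof -
  have h1: "h \<in> L2 (lebesgue_on {0..1})"
    by (rule L2_lebesgue_on_subset[OF h]) (simp_all add: two_intervals_def)
  have h2: "h \<in> L2 (lebesgue_on {\<alpha>..\<beta>})"
    by (rule L2_lebesgue_on_subset[OF h]) (simp_all add: two_intervals_def)
  have shift: "ee (z * of_real (x - \<alpha>)) = ee (z * of_real x) * ee (- z * of_real \<alpha>)" for x
    by (simp add: algebra_simps flip: ee_add)
  show ?thesis
    unfolding resolvent_eq_two_intervals[OF \<alpha>(1)] resolvent_eq_interval_iff[OF h1]
      resolvent_eq_interval_iff[OF h2] shift
    by (simp add: forcing_def distrib_left mult.assoc)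
qed

lemma boundary_condition_iff:
  fixes A :: "complex^2^2"
  assumes "f 1 = ee z * f 0 + r1" "f \<beta> = ee (z * of_real (\<beta> - \<alpha>)) * f \<alpha> + r2"
  shows "A *v vector [f 1, f \<beta>] = vector [f 0, f \<alpha>] \<longleftrightarrow>
    (mat 1 - A ** propagator \<alpha> \<beta> z) *v vector [f 0, f \<alpha>] = A *v vector [r1, r2]"
proof -
  have "vector [f 1, f \<beta>] = propagator \<alpha> \<beta> z *v vector [f 0, f \<alpha>] + vector [r1, r2]"
    using assms by (simp add: vec_eq_iff forall_2 matrix_vector_mult_def sum_2 propagator_def)
  then have "A *v vector [f 1, f \<beta>]
      = (A ** propagator \<alpha> \<beta> z) *v vector [f 0, f \<alpha>] + A *v vector [r1, r2]"
    by (simp only: matrix_vector_right_distrib matrix_vector_mul_assoc)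
  then show ?thesis
    unfolding matrix_vector_mult_diff_rdistrib matrix_vector_mul_lid diff_eq_eq
    by (metis add.commute)
qed

text \<open>The bound has to be uniform in \<open>h\<close> and \<open>x\<close>; it holds because the
  exponentials are bounded on an interval containing both components.\<close>
lemma forcing_bound:
  obtains K where "K \<ge> 0" "\<And>h x. h \<in> L2 (lebesgue_on (two_intervals \<alpha> \<beta>)) \<Longrightarrow> {l..x} \<subseteq> two_intervals \<alpha> \<beta> \<Longrightarrow>
      l \<le> x \<Longrightarrow> norm (forcing z h l x) \<le> K * L2_norm (lebesgue_on (two_intervals \<alpha> \<beta>)) h"
proof -
  let ?S = "two_intervals \<alpha> \<beta>"
  define a where "a = min 0 \<alpha>"
  define b where "b = max 1 \<beta>"
  have sub: "?S \<subseteq> {a..b}" by (auto simp: two_intervals_def a_def b_def)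
  obtain C1 where C1: "C1 > 0" "\<And>x. x \<in> {a..b} \<Longrightarrow> norm (ee (z * of_real x)) \<le> C1"
    using ee_bounded[of a b z] by blast
  obtain C2 where C2: "C2 > 0" "\<And>x. x \<in> {a..b} \<Longrightarrow> norm (ee (- z * of_real x)) \<le> C2"
    using ee_bounded[of a b "- z"] by blast
  define m where "m = measure lebesgue ?S"
  show ?thesis
  proof (rule that)
    show "C1 * (2 * pi * (C2 * (m + 1) / 2)) \<ge> 0"
      using C1(1) C2(1) by (simp add: m_def)
    fix h x assume h: "h \<in> L2 (lebesgue_on ?S)" and x: "{l..x} \<subseteq> ?S" "l \<le> x"
    have "norm (integral {l..x} (\<lambda>t. ee (- z * of_real t) * h t)) \<le> C2 * (m + 1) / 2 * L2_norm (lebesgue_on ?S) h"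
      unfolding m_def
      by (rule norm_integral_le_L2_norm[OF h two_intervals_lmeasurable x(1)])
         (use C2 sub in \<open>auto intro!: continuous_imp_measurable_on_sets_lebesgue continuous_intros
            fmeasurableD two_intervals_lmeasurable\<close>)
    moreover have "x \<in> {a..b}" using x sub atLeastAtMost_iff by blast
    then have "norm (ee (z * of_real x)) \<le> C1" by (rule C1(2))
    ultimately have "norm (ee (z * of_real x)) * (2 * pi * norm (integral {l..x} (\<lambda>t. ee (- z * of_real t) * h t)))
        \<le> C1 * (2 * pi * (C2 * (m + 1) / 2 * L2_norm (lebesgue_on ?S) h))"
      using C1(1) by (intro mult_mono mult_left_mono) auto
    then show "norm (forcing z h l x) \<le> C1 * (2 * pi * (C2 * (m + 1) / 2)) * L2_norm (lebesgue_on ?S) h"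
      by (simp add: forcing_def norm_mult algebra_simps)
  qed
qed

text \<open>An a priori bound in the supremum norm. It gives at once the bound for the inverse operator and, for
  \<open>h = 0\<close>, uniqueness. The initial values are \<open>(1 - A D)\<^sup>-\<^sup>1 A r\<close>, hence
  bounded by a multiple of the forcing terms \<open>r\<close>, which are controlled by the \<open>L\<^sup>2\<close> norm
  of \<open>h\<close>.\<close>
lemma resolvent_eq_bound:
  fixes A :: "complex^2^2"
  assumes \<alpha>: "1 < \<alpha>" "\<alpha> < \<beta>" and det: "det (mat 1 - A ** propagator \<alpha> \<beta> z) \<noteq> 0"
  obtains C where "C \<ge> 0"
    "\<And>h f x. h \<in> L2 (lebesgue_on (two_intervals \<alpha> \<beta>)) \<Longrightarrow> resolvent_eq (two_intervals \<alpha> \<beta>) z h f \<Longrightarrow>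
       A *v vector [f 1, f \<beta>] = vector [f 0, f \<alpha>] \<Longrightarrow> x \<in> two_intervals \<alpha> \<beta> \<Longrightarrow>
       norm (f x) \<le> C * L2_norm (lebesgue_on (two_intervals \<alpha> \<beta>)) h"
proof -
  let ?S = "two_intervals \<alpha> \<beta>"
  obtain K1 where K1: "K1 \<ge> 0" "\<And>h x. h \<in> L2 (lebesgue_on ?S) \<Longrightarrow> {0..x} \<subseteq> ?S \<Longrightarrow>
      0 \<le> x \<Longrightarrow> norm (forcing z h 0 x) \<le> K1 * L2_norm (lebesgue_on ?S) h"
    by (rule forcing_bound[where l = 0 and z = z and \<alpha> = \<alpha> and \<beta> = \<beta>]) blast
  obtain K2 where K2: "K2 \<ge> 0" "\<And>h x. h \<in> L2 (lebesgue_on ?S) \<Longrightarrow> {\<alpha>..x} \<subseteq> ?S \<Longrightarrow>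
      \<alpha> \<le> x \<Longrightarrow> norm (forcing z h \<alpha> x) \<le> K2 * L2_norm (lebesgue_on ?S) h"
    by (rule forcing_bound[where l = \<alpha> and z = z and \<alpha> = \<alpha> and \<beta> = \<beta>]) blast
  obtain Q where Q: "Q ** (mat 1 - A ** propagator \<alpha> \<beta> z) = mat 1"
    using det by (metis invertible_det_nz invertible_left_inverse)
  obtain L where L: "L > 0" "\<And>v. norm ((Q ** A) *v v) \<le> L * norm v"
    using bounded_linear.pos_bounded[OF matrix_vector_mul_bounded_linear[of "Q ** A"]]
    by (metis mult.commute)
  obtain C1 where C1: "C1 > 0" "\<And>x. x \<in> {0..max 1 (\<beta> - \<alpha>)} \<Longrightarrow> norm (ee (z * of_real x)) \<le> C1"
    using ee_bounded[of 0 "max 1 (\<beta> - \<alpha>)" z] by blast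
  define C where "C = C1 * (L * (K1 + K2)) + (K1 + K2)"
  show ?thesis
  proof (rule that)
    show "C \<ge> 0" using C1(1) L(1) K1(1) K2(1) by (simp add: C_def)
    fix h f x
    assume h: "h \<in> L2 (lebesgue_on ?S)" and f: "resolvent_eq ?S z h f"
      and bc: "A *v vector [f 1, f \<beta>] = vector [f 0, f \<alpha>]" and x: "x \<in> ?S"
    define H where "H = L2_norm (lebesgue_on ?S) h"
    have H: "H \<ge> 0" by (simp add: H_def)
    have f1: "f y = ee (z * of_real y) * f 0 + forcing z h 0 y" if "y \<in> {0..1}" for y
      using f resolvent_eq_iff_propagated[OF h \<alpha>] that by blast
    have f2: "f y = ee (z * of_real (y - \<alpha>)) * f \<alpha> + forcing z h \<alpha> y" if "y \<in> {\<alpha>..\<beta>}" for y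
      using f resolvent_eq_iff_propagated[OF h \<alpha>] that by blast
    have s1: "norm (forcing z h 0 y) \<le> K1 * H" if "y \<in> {0..1}" for y
      unfolding H_def using that by (intro K1(2) h) (auto simp: two_intervals_def)
    have s2: "norm (forcing z h \<alpha> y) \<le> K2 * H" if "y \<in> {\<alpha>..\<beta>}" for y
      unfolding H_def using that by (intro K2(2) h) (auto simp: two_intervals_def)
    let ?R = "vector [forcing z h 0 1, forcing z h \<alpha> \<beta>] :: complex^2"
    have "(mat 1 - A ** propagator \<alpha> \<beta> z) *v vector [f 0, f \<alpha>] = A *v ?R"
      using bc boundary_condition_iff[of f z _ \<beta> \<alpha>] f1[of 1] f2[of \<beta>] \<alpha> by simp
    then have "Q *v ((mat 1 - A ** propagator \<alpha> \<beta> z) *v vector [f 0, f \<alpha>]) = Q *v (A *v ?R)"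
      by simp
    then have sol: "vector [f 0, f \<alpha>] = (Q ** A) *v ?R"
      by (simp only: matrix_vector_mul_assoc Q matrix_vector_mul_lid)
    have "norm ?R \<le> norm (forcing z h 0 1) + norm (forcing z h \<alpha> \<beta>)"
      unfolding norm_vec_def by (rule order_trans[OF L2_set_le_sum]) (simp_all add: sum_2)
    also have "\<dots> \<le> K1 * H + K2 * H" using s1[of 1] s2[of \<beta>] \<alpha> by simp
    finally have R: "norm ?R \<le> (K1 + K2) * H" by (simp add: distrib_right)
    have "norm (vector [f 0, f \<alpha>] :: complex^2) \<le> L * norm ?R" unfolding sol by (rule L(2))
    also have "\<dots> \<le> L * ((K1 + K2) * H)" using R L(1) by (simp add: mult_left_mono)
    finally have "norm (vector [f 0, f \<alpha>] :: complex^2) \<le> L * (K1 + K2) * H" by (simp add: mult.assoc)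
    then have init: "norm (f 0) \<le> L * (K1 + K2) * H" "norm (f \<alpha>) \<le> L * (K1 + K2) * H"
      using Finite_Cartesian_Product.norm_nth_le[of "vector [f 0, f \<alpha>] :: complex^2" 1]
        Finite_Cartesian_Product.norm_nth_le[of "vector [f 0, f \<alpha>] :: complex^2" 2] by auto
    have step: "norm (ee (z * of_real y) * c + s) \<le> C * H"
      if "y \<in> {0..max 1 (\<beta> - \<alpha>)}" "norm c \<le> L * (K1 + K2) * H" "norm s \<le> (K1 + K2) * H" for y c s
    proof -
      have "norm (ee (z * of_real y) * c + s) \<le> norm (ee (z * of_real y)) * norm c + norm s"
        by (metis norm_triangle_ineq norm_mult)
      also have "\<dots> \<le> C1 * (L * (K1 + K2) * H) + (K1 + K2) * H"
        using C1 that by (intro add_mono mult_mono) auto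
      finally show ?thesis by (simp add: C_def algebra_simps)
    qed
    have K: "K1 * H \<le> (K1 + K2) * H" "K2 * H \<le> (K1 + K2) * H"
      using K1(1) K2(1) H by (simp_all add: mult_right_mono)
    consider "x \<in> {0..1}" | "x \<in> {\<alpha>..\<beta>}" using x by (auto simp: two_intervals_def)
    then have "norm (f x) \<le> C * H"
    proof cases
      case 1
      have "norm (forcing z h 0 x) \<le> (K1 + K2) * H" using s1[OF 1] K(1) by linarith
      then show ?thesis unfolding f1[OF 1] using 1 by (intro step init) auto
    next
      case 2
      have "norm (forcing z h \<alpha> x) \<le> (K1 + K2) * H" using s2[OF 2] K(2) by linarith
      then show ?thesis unfolding f2[OF 2] using 2 by (intro step init) auto
    qed
    then show "norm (f x) \<le> C * L2_norm (lebesgue_on ?S) h" by (simp add: H_def)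
  qed
qed

section \<open>The spectrum for an arbitrary boundary matrix\<close>

lemma PB_domain_resolvent_iff:
  assumes "h \<in> L2 (lebesgue_on (two_intervals \<alpha> \<beta>))"
  shows "f \<in> PB_domain \<alpha> \<beta> A \<and> (AE x in lebesgue_on (two_intervals \<alpha> \<beta>). momentum_op f x - z * f x = h x)
    \<longleftrightarrow> resolvent_eq (two_intervals \<alpha> \<beta>) z h f \<and> A *v vector [f 1, f \<beta>] = vector [f 0, f \<alpha>]"
  unfolding resolvent_eq_iff_P_domain[OF assms] PB_domain_def mem_Collect_eq by argo

lemma resolvent_eq_solvable:
  assumes h: "h \<in> L2 (lebesgue_on (two_intervals \<alpha> \<beta>))" and \<alpha>: "1 < \<alpha>" "\<alpha> < \<beta>"
  obtains f where "resolvent_eq (two_intervals \<alpha> \<beta>) z h f" "f 0 = a" "f \<alpha> = b"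
    "f 1 = ee z * a + forcing z h 0 1" "f \<beta> = ee (z * of_real (\<beta> - \<alpha>)) * b + forcing z h \<alpha> \<beta>"
proof -
  define f where "f = (\<lambda>x. if x \<le> 1 then ee (z * of_real x) * a + forcing z h 0 x
      else ee (z * of_real (x - \<alpha>)) * b + forcing z h \<alpha> x)"
  have 0: "f 0 = a" "f \<alpha> = b" using \<alpha> by (simp_all add: f_def forcing_def)
  show ?thesis
  proof (rule that)
    show "resolvent_eq (two_intervals \<alpha> \<beta>) z h f"
      unfolding resolvent_eq_iff_propagated[OF h \<alpha>] 0 using \<alpha> by (auto simp: f_def)
  qed (use \<alpha> 0 in \<open>simp_all add: f_def\<close>)
qed

lemma L2_zero [simp]: "(\<lambda>x. 0) \<in> L2 M"
  by (simp add: L2_def)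

lemma forcing_zero [simp]: "forcing z (\<lambda>t. 0) l x = 0"
  by (simp add: forcing_def)

lemma not_AE_zero_two_intervals:
  assumes "\<And>x. x \<in> {l..r} \<Longrightarrow> f x \<noteq> 0" "l < r" "{l..r} \<subseteq> two_intervals \<alpha> \<beta>"
  shows "\<not> (AE x in lebesgue_on (two_intervals \<alpha> \<beta>). f x = 0)"
proof
  assume "AE x in lebesgue_on (two_intervals \<alpha> \<beta>). f x = 0"
  then have "negligible {x \<in> two_intervals \<alpha> \<beta>. f x \<noteq> 0}"
    unfolding AE_lebesgue_on_iff_negligible[OF fmeasurableD[OF two_intervals_lmeasurable]] .
  then have "negligible {l..r}"
    by (rule negligible_subset) (use assms(1,3) in blast)
  then show False
    using assms(2) negligible_interval(1)[of l r] unfolding box_real by simp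
qed

text \<open>If the determinant is nonzero, solving the linear system for the initial values gives existence,
  and the a priori bound gives the rest. If it vanishes, the equation with \<open>h = 0\<close> has a solution with nonzero
  initial values besides the zero function, so the operator \<open>P - z\<close> is not injective.\<close>
theorem PB_spectrum_eq_det:
  fixes A :: "complex^2^2"
  assumes \<alpha>: "1 < \<alpha>" "\<alpha> < \<beta>"
  shows "PB_spectrum \<alpha> \<beta> A = {z. det (mat 1 - A ** propagator \<alpha> \<beta> z) = 0}"
proof -
  let ?M = "lebesgue_on (two_intervals \<alpha> \<beta>)" and ?S = "two_intervals \<alpha> \<beta>"
  have "z \<in> resolvent_set ?M (PB_domain \<alpha> \<beta> A) momentum_op"
    if det: "det (mat 1 - A ** propagator \<alpha> \<beta> z) \<noteq> 0" for z
  proof -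
    obtain C where C: "C \<ge> 0" "\<And>h f x. h \<in> L2 ?M \<Longrightarrow> resolvent_eq ?S z h f \<Longrightarrow>
       A *v vector [f 1, f \<beta>] = vector [f 0, f \<alpha>] \<Longrightarrow> x \<in> ?S \<Longrightarrow> norm (f x) \<le> C * L2_norm ?M h"
      by (rule resolvent_eq_bound[OF \<alpha> det]) blast
    obtain Q where Q: "(mat 1 - A ** propagator \<alpha> \<beta> z) ** Q = mat 1"
      using det unfolding invertible_det_nz[symmetric] invertible_right_inverse by blast
    have ex: "\<exists>f\<in>PB_domain \<alpha> \<beta> A. (AE x in ?M. momentum_op f x - z * f x = h x) \<and>
        (\<forall>f'\<in>PB_domain \<alpha> \<beta> A. (AE x in ?M. momentum_op f' x - z * f' x = h x) \<longrightarrow> (AE x in ?M. f' x = f x))"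
      if h: "h \<in> L2 ?M" for h
    proof -
      define R :: "complex^2" where "R = vector [forcing z h 0 1, forcing z h \<alpha> \<beta>]"
      define v where "v = Q *v (A *v R)"
      obtain f where f: "resolvent_eq ?S z h f" "f 0 = v $ 1" "f \<alpha> = v $ 2"
        "f 1 = ee z * v $ 1 + forcing z h 0 1" "f \<beta> = ee (z * of_real (\<beta> - \<alpha>)) * v $ 2 + forcing z h \<alpha> \<beta>"
        by (rule resolvent_eq_solvable[OF h \<alpha>, where z = z and a = "v $ 1" and b = "v $ 2"]) blast
      have v: "vector [f 0, f \<alpha>] = v" by (simp add: vec_eq_iff forall_2 f(2,3))
      have "(mat 1 - A ** propagator \<alpha> \<beta> z) *v v = A *v R"
        by (simp only: v_def matrix_vector_mul_assoc Q matrix_vector_mul_lid matrix_mul_assoc matrix_mul_lid)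
      moreover have ends: "f 1 = ee z * f 0 + forcing z h 0 1"
        "f \<beta> = ee (z * of_real (\<beta> - \<alpha>)) * f \<alpha> + forcing z h \<alpha> \<beta>"
        unfolding f(2,3) by (fact f(4), fact f(5))
      ultimately have bc: "A *v vector [f 1, f \<beta>] = vector [f 0, f \<alpha>]"
        unfolding boundary_condition_iff[of f z _ \<beta> \<alpha>, OF ends]
        unfolding v R_def by blast
      have uniq: "f' x = f x" if f': "resolvent_eq ?S z h f'"
        "A *v vector [f' 1, f' \<beta>] = vector [f' 0, f' \<alpha>]" and x: "x \<in> ?S" for f' x
      proof -
        define u where "u = (\<lambda>x. f' x - f x)"
        have "resolvent_eq ?S z (\<lambda>x. 0) u"
        proof (rule resolvent_eq_iff_propagated[OF L2_zero \<alpha>, THEN iffD2], intro conjI ballI)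
          note vals = resolvent_eq_iff_propagated[OF h \<alpha>, THEN iffD1, OF f(1)]
            resolvent_eq_iff_propagated[OF h \<alpha>, THEN iffD1, OF f'(1)]
          fix x
          show "u x = ee (z * of_real x) * u 0 + forcing z (\<lambda>x. 0) 0 x" if x: "x \<in> {0..1}"
            using bspec[OF vals(1)[THEN conjunct1] x] bspec[OF vals(2)[THEN conjunct1] x]
            by (simp add: u_def right_diff_distrib)
          show "u x = ee (z * of_real (x - \<alpha>)) * u \<alpha> + forcing z (\<lambda>x. 0) \<alpha> x" if x: "x \<in> {\<alpha>..\<beta>}"
            using bspec[OF vals(1)[THEN conjunct2] x] bspec[OF vals(2)[THEN conjunct2] x]
            by (simp add: u_def right_diff_distrib)
        qed
        moreover have "A *v vector [u 1, u \<beta>] = vector [u 0, u \<alpha>]"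
        proof -
          have "vector [u 1, u \<beta>] = (vector [f' 1, f' \<beta>] - vector [f 1, f \<beta>] :: complex^2)"
            "vector [u 0, u \<alpha>] = (vector [f' 0, f' \<alpha>] - vector [f 0, f \<alpha>] :: complex^2)"
            by (simp_all add: vec_eq_iff forall_2 u_def)
          then show ?thesis using bc f'(2) by (simp only: matrix_vector_mult_diff_distrib)
        qed
        ultimately have "norm (u x) \<le> C * L2_norm ?M (\<lambda>x. 0)"
          by (rule C(2)[OF L2_zero _ _ x])
        then show ?thesis by (simp add: L2_norm_def u_def)
      qed
      show ?thesis
      proof (intro bexI[of _ f] conjI ballI impI)
        show "AE x in ?M. momentum_op f x - z * f x = h x" "f \<in> PB_domain \<alpha> \<beta> A"
          by (rule PB_domain_resolvent_iff[OF h, THEN iffD2, OF conjI[OF f(1) bc], THEN conjunct2],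
              rule PB_domain_resolvent_iff[OF h, THEN iffD2, OF conjI[OF f(1) bc], THEN conjunct1])
        fix f' assume "f' \<in> PB_domain \<alpha> \<beta> A" "AE x in ?M. momentum_op f' x - z * f' x = h x"
        note PB_domain_resolvent_iff[OF h, THEN iffD1, OF conjI[OF this]]
        from uniq[OF this[THEN conjunct1] this[THEN conjunct2]] show "AE x in ?M. f' x = f x" by (intro AE_I2) simp
      qed
    qed
    moreover have "L2_norm ?M f \<le> C * sqrt (measure lebesgue ?S) * L2_norm ?M (\<lambda>x. momentum_op f x - z * f x)"
      if f: "f \<in> PB_domain \<alpha> \<beta> A" for f
    proof -
      let ?h = "\<lambda>x. momentum_op f x - z * f x"
      have h: "?h \<in> L2 ?M"
        using f by (intro momentum_op_minus_in_L2) (simp add: PB_domain_def)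
      have "resolvent_eq ?S z ?h f \<and> A *v vector [f 1, f \<beta>] = vector [f 0, f \<alpha>]"
        by (rule PB_domain_resolvent_iff[THEN iffD1, OF h]) (simp add: f)
      note bd = C(2)[OF h this[THEN conjunct1] this[THEN conjunct2]]
      define c where "c = C * L2_norm ?M ?h"
      have c: "c \<ge> 0" using C(1) by (simp add: c_def)
      have "(LINT x|?M. (norm (f x))\<^sup>2) \<le> (LINT x|?M. c\<^sup>2)"
      proof (rule integral_mono')
        show "integrable ?M (\<lambda>x. c\<^sup>2)"
          by (rule finite_measure.integrable_const[OF finite_measure_lebesgue_on[OF two_intervals_lmeasurable]])
        show "(norm (f x))\<^sup>2 \<le> c\<^sup>2" if "x \<in> space ?M" for x
          unfolding c_def using that by (intro power_mono bd) simp_all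
      qed simp
      also have "\<dots> = measure lebesgue ?S * c\<^sup>2"
        by (simp add: measure_restrict_space fmeasurableD[OF two_intervals_lmeasurable])
      finally have "L2_norm ?M f \<le> sqrt (measure lebesgue ?S * c\<^sup>2)"
        by (simp add: L2_norm_def)
      also have "\<dots> = sqrt (measure lebesgue ?S) * c" using c by (simp add: real_sqrt_mult)
      finally show ?thesis by (simp add: c_def mult.assoc mult.left_commute)
    qed
    ultimately show ?thesis unfolding resolvent_set_def by blast
  qed
  moreover have "z \<notin> resolvent_set ?M (PB_domain \<alpha> \<beta> A) momentum_op"
    if det: "det (mat 1 - A ** propagator \<alpha> \<beta> z) = 0" for z
  proof
    assume z: "z \<in> resolvent_set ?M (PB_domain \<alpha> \<beta> A) momentum_op"
    obtain v where v: "(mat 1 - A ** propagator \<alpha> \<beta> z) *v v = 0" "v \<noteq> 0"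
      using det invertible_det_nz[of "mat 1 - A ** propagator \<alpha> \<beta> z"]
      unfolding invertible_left_inverse matrix_left_invertible_ker by blast
    have sol: "\<exists>f\<in>PB_domain \<alpha> \<beta> A. (AE x in ?M. momentum_op f x - z * f x = 0) \<and> f 0 = w $ 1 \<and> f \<alpha> = w $ 2
        \<and> resolvent_eq ?S z (\<lambda>x. 0) f"
      if w: "(mat 1 - A ** propagator \<alpha> \<beta> z) *v w = 0" for w
    proof -
      obtain f where f: "resolvent_eq ?S z (\<lambda>x. 0) f" "f 0 = w $ 1" "f \<alpha> = w $ 2"
        "f 1 = ee z * w $ 1 + forcing z (\<lambda>x. 0) 0 1"
        "f \<beta> = ee (z * of_real (\<beta> - \<alpha>)) * w $ 2 + forcing z (\<lambda>x. 0) \<alpha> \<beta>"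
        by (rule resolvent_eq_solvable[OF L2_zero \<alpha>, where z = z and a = "w $ 1" and b = "w $ 2"]) blast
      have wv: "vector [f 0, f \<alpha>] = w" "vector [0, 0] = (0 :: complex^2)" by (simp_all add: vec_eq_iff forall_2 f(2,3))
      have ends: "f 1 = ee z * f 0 + 0" "f \<beta> = ee (z * of_real (\<beta> - \<alpha>)) * f \<alpha> + 0"
        unfolding f(2,3) using f(4,5) by simp_all
      have "A *v vector [f 1, f \<beta>] = vector [f 0, f \<alpha>]"
        unfolding boundary_condition_iff[of f z _ \<beta> \<alpha>, OF ends]
        unfolding wv w by simp
      from PB_domain_resolvent_iff[OF L2_zero, THEN iffD2, OF conjI[OF f(1) this]]
      show ?thesis using f(1-3) by blast
    qed
    obtain f where f: "f \<in> PB_domain \<alpha> \<beta> A" "AE x in ?M. momentum_op f x - z * f x = 0"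
        "f 0 = v $ 1" "f \<alpha> = v $ 2" "resolvent_eq ?S z (\<lambda>x. 0) f"
      using sol[OF v(1)] by blast
    obtain g where g: "g \<in> PB_domain \<alpha> \<beta> A" "AE x in ?M. momentum_op g x - z * g x = 0"
        "g 0 = 0" "g \<alpha> = 0" "resolvent_eq ?S z (\<lambda>x. 0) g"
      using sol[of 0] by auto
    have "\<forall>h\<in>L2 ?M. \<exists>e\<in>PB_domain \<alpha> \<beta> A. (AE x in ?M. momentum_op e x - z * e x = h x) \<and>
        (\<forall>f'\<in>PB_domain \<alpha> \<beta> A. (AE x in ?M. momentum_op f' x - z * f' x = h x) \<longrightarrow> (AE x in ?M. f' x = e x))"
      using z unfolding resolvent_set_def mem_Collect_eq by (rule conjunct1)
    from bspec[OF this L2_zero] obtain e where e: "\<forall>f'\<in>PB_domain \<alpha> \<beta> A.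
        (AE x in ?M. momentum_op f' x - z * f' x = 0) \<longrightarrow> (AE x in ?M. f' x = e x)"
      by blast
    have "AE x in ?M. f x - g x = 0"
      using e[THEN bspec, OF f(1), THEN mp, OF f(2)] e[THEN bspec, OF g(1), THEN mp, OF g(2)]
      by eventually_elim simp
    moreover have "\<not> (AE x in ?M. f x - g x = 0)"
    proof -
      have fx: "f x - g x = ee (z * of_real x) * v $ 1" if "x \<in> {0..1}" for x
      proof -
        have "f x = ee (z * of_real x) * f 0" "g x = ee (z * of_real x) * g 0"
          using bspec[OF resolvent_eq_iff_propagated[OF L2_zero \<alpha>, THEN iffD1, OF f(5), THEN conjunct1] that]
            bspec[OF resolvent_eq_iff_propagated[OF L2_zero \<alpha>, THEN iffD1, OF g(5), THEN conjunct1] that]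
          by simp_all
        then show ?thesis by (simp add: f(3) g(3))
      qed
      have fx': "f x - g x = ee (z * of_real (x - \<alpha>)) * v $ 2" if "x \<in> {\<alpha>..\<beta>}" for x
      proof -
        have "f x = ee (z * of_real (x - \<alpha>)) * f \<alpha>" "g x = ee (z * of_real (x - \<alpha>)) * g \<alpha>"
          using bspec[OF resolvent_eq_iff_propagated[OF L2_zero \<alpha>, THEN iffD1, OF f(5), THEN conjunct2] that]
            bspec[OF resolvent_eq_iff_propagated[OF L2_zero \<alpha>, THEN iffD1, OF g(5), THEN conjunct2] that]
          by (simp_all del: of_real_diff)
        then show ?thesis by (simp add: f(4) g(4) del: of_real_diff)
      qed
      have "v $ 1 \<noteq> 0 \<or> v $ 2 \<noteq> 0" using v(2) by (auto simp: vec_eq_iff forall_2)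
      then show ?thesis
      proof
        assume "v $ 1 \<noteq> 0"
        then show ?thesis
          by (intro not_AE_zero_two_intervals[of 0 1]) (simp_all add: fx two_intervals_def)
      next
        assume "v $ 2 \<noteq> 0"
        then show ?thesis
          using \<alpha> by (intro not_AE_zero_two_intervals[of \<alpha> \<beta>]) (simp_all add: fx' two_intervals_def del: of_real_diff)
      qed
    qed
    ultimately show False by blast
  qed
  ultimately show ?thesis
    unfolding PB_spectrum_def operator_spectrum_def by blast
qed

section \<open>The case of vanishing \<open>w\<close>\<close>

text \<open>The piecewise exponentials solve the equation with \<open>h = 0\<close> for all
  \<open>z\<close>, \<open>a\<close> and \<open>b\<close>, so only the boundary condition remains.\<close>
lemma PB_eigenfunction_plane_wave_iff:
  fixes A :: "complex^2^2" and a b z :: complex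
  assumes \<alpha>: "1 < \<alpha>" "\<alpha> < \<beta>"
  shows "PB_eigenfunction \<alpha> \<beta> A z
      (\<lambda>x. (a * indicator {0..1} x + b * indicator {\<alpha>..\<beta>} x) * ee (z * of_real x)) \<longleftrightarrow>
    (a \<noteq> 0 \<or> b \<noteq> 0) \<and>
    A *v vector [a * ee z, b * ee (z * of_real \<beta>)] = vector [a, b * ee (z * of_real \<alpha>)]"
proof -
  let ?M = "lebesgue_on (two_intervals \<alpha> \<beta>)"
  define F where "F = (\<lambda>x. (a * indicator {0..1} x + b * indicator {\<alpha>..\<beta>} x) * ee (z * of_real x))"
  have F1: "F x = a * ee (z * of_real x)" if "x \<in> {0..1}" for x
    using that \<alpha> by (auto simp: F_def indicator_def)
  have F2: "F x = b * ee (z * of_real x)" if "x \<in> {\<alpha>..\<beta>}" for x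
    using that \<alpha> by (auto simp: F_def indicator_def)
  have ends: "F 0 = a" "F 1 = a * ee z" "F \<alpha> = b * ee (z * of_real \<alpha>)" "F \<beta> = b * ee (z * of_real \<beta>)"
    using \<alpha> F1[of 0] F1[of 1] F2[of \<alpha>] F2[of \<beta>] by auto
  have sol: "resolvent_eq (two_intervals \<alpha> \<beta>) z (\<lambda>x. 0) F"
  proof (rule resolvent_eq_iff_propagated[OF L2_zero \<alpha>, THEN iffD2], intro conjI ballI)
    fix x assume x: "x \<in> {\<alpha>..\<beta>}"
    have "ee (z * of_real (x - \<alpha>)) * ee (z * of_real \<alpha>) = ee (z * of_real x)"
      by (simp add: algebra_simps flip: ee_add)
    then show "F x = ee (z * of_real (x - \<alpha>)) * F \<alpha> + forcing z (\<lambda>x. 0) \<alpha> x"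
      unfolding ends F2[OF x] by (simp add: mult.left_commute del: of_real_diff)
  qed (simp add: ends F1)
  have nz: "(AE x in ?M. F x = 0) \<longleftrightarrow> a = 0 \<and> b = 0"
  proof
    assume ae: "AE x in ?M. F x = 0"
    have "a = 0"
    proof (rule ccontr)
      assume "a \<noteq> 0"
      then have "F x \<noteq> 0" if "x \<in> {0..1}" for x using F1[OF that] by simp
      from not_AE_zero_two_intervals[of 0 1, OF this] ae show False by (simp add: two_intervals_def)
    qed
    moreover have "b = 0"
    proof (rule ccontr)
      assume "b \<noteq> 0"
      then have "F x \<noteq> 0" if "x \<in> {\<alpha>..\<beta>}" for x using F2[OF that] by simp
      from not_AE_zero_two_intervals[of \<alpha> \<beta>, OF this] ae \<alpha>(2) show False by (simp add: two_intervals_def)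
    qed
    ultimately show "a = 0 \<and> b = 0" ..
  qed (simp add: F_def)
  have "PB_eigenfunction \<alpha> \<beta> A z F \<longleftrightarrow> \<not> (AE x in ?M. F x = 0) \<and>
      F \<in> PB_domain \<alpha> \<beta> A \<and> (AE x in ?M. momentum_op F x - z * F x = 0)"
    unfolding PB_eigenfunction_def eigenfunction_def right_minus_eq by argo
  also have "\<dots> \<longleftrightarrow> (a \<noteq> 0 \<or> b \<noteq> 0) \<and> A *v vector [F 1, F \<beta>] = vector [F 0, F \<alpha>]"
    unfolding PB_domain_resolvent_iff[OF L2_zero] nz using sol by argo
  finally show ?thesis unfolding ends unfolding F_def .
qed

lemma det_boundary_w_zero:
  "det (mat 1 - B_matrix 0 \<phi> \<psi> \<theta> ** propagator \<alpha> \<beta> z) = 1 + ee (of_real \<theta> + z * of_real (1 + \<beta> - \<alpha>))"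
proof -
  have "ee (of_real (\<theta> - \<psi>)) * ee (z * of_real (\<beta> - \<alpha>)) * (ee (of_real \<psi>) * ee z)
      = ee (of_real \<theta> + z * of_real (1 + \<beta> - \<alpha>))"
    by (simp add: algebra_simps flip: ee_add)
  then show ?thesis
    by (simp add: det_2 B_matrix_def propagator_def matrix_matrix_mult_def mat_def sum_2 mult.assoc del: of_real_diff)
qed

lemma PB_spectrum_w_zero:
  assumes \<alpha>: "1 < \<alpha>" "\<alpha> < \<beta>"
  shows "PB_spectrum \<alpha> \<beta> (B_matrix 0 \<phi> \<psi> \<theta>) =
    {complex_of_real ((1/2 - \<theta>) / (1 + \<beta> - \<alpha>) + 1 / (1 + \<beta> - \<alpha>) * of_int n) | n :: int. True}"
proof -
  define L where "L = 1 + \<beta> - \<alpha>"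
  have L: "complex_of_real L \<noteq> 0" using \<alpha> by (simp add: L_def del: of_real_diff of_real_add)
  \<comment> \<open>The value \<open>-1\<close> turns the zeros of the determinant into solutions of \<open>ee _ = 1\<close>.\<close>
  have half: "ee (- (1/2)) = -1" by (simp add: ee_def exp_minus)
  have "1 + ee (of_real \<theta> + z * of_real L) = 0 \<longleftrightarrow>
      (\<exists>n::int. z = of_real ((1/2 - \<theta>) / L + 1 / L * of_int n))" for z
  proof -
    have "1 + ee (of_real \<theta> + z * of_real L) = 0 \<longleftrightarrow> ee (of_real \<theta> + z * of_real L + - (1/2)) = 1"
      unfolding ee_add half by (auto simp: add_eq_0_iff minus_equation_iff)
    also have "\<dots> \<longleftrightarrow> (\<exists>n::int. of_real \<theta> + z * of_real L + - (1/2) = of_int n)"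
      by (rule ee_eq_1_iff)
    also have "\<dots> \<longleftrightarrow> (\<exists>n::int. z = of_real ((1/2 - \<theta>) / L + 1 / L * of_int n))"
    proof (intro ex_cong1)
      fix n :: int
      show "of_real \<theta> + z * of_real L + - (1/2) = of_int n \<longleftrightarrow> z = of_real ((1/2 - \<theta>) / L + 1 / L * of_int n)"
        using L by (auto simp: field_simps)
    qed
    finally show ?thesis .
  qed
  then show ?thesis
    unfolding PB_spectrum_eq_det[OF \<alpha>] det_boundary_w_zero L_def[symmetric] by simp
qed

text \<open>The second row of the boundary condition expresses \<open>b\<close> through \<open>a\<close>. For
  \<open>z\<close> in the spectrum, the first row then follows from the vanishing of the
  determinant.\<close>
lemma PB_eigenfunction_w_zero_iff:
  fixes a b z :: complex
  assumes \<alpha>: "1 < \<alpha>" "\<alpha> < \<beta>" and z: "z \<in> PB_spectrum \<alpha> \<beta> (B_matrix 0 \<phi> \<psi> \<theta>)"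
  shows "PB_eigenfunction \<alpha> \<beta> (B_matrix 0 \<phi> \<psi> \<theta>) z
      (\<lambda>x. (a * indicator {0..1} x + b * indicator {\<alpha>..\<beta>} x) * ee (z * of_real x)) \<longleftrightarrow>
    a \<noteq> 0 \<and> b = a * ee (of_real \<psi> + z * of_real (1 - \<alpha>))"
proof -
  have spec: "ee (of_real \<theta> + z * of_real (1 + \<beta> - \<alpha>)) = - 1"
    using z unfolding PB_spectrum_eq_det[OF \<alpha>] det_boundary_w_zero by (simp add: add_eq_0_iff del: of_real_diff of_real_add)
  have "B_matrix 0 \<phi> \<psi> \<theta> *v vector [a * ee z, b * ee (z * of_real \<beta>)] = vector [a, b * ee (z * of_real \<alpha>)]
      \<longleftrightarrow> - (ee (of_real (\<theta> - \<psi>)) * (b * ee (z * of_real \<beta>))) = a \<and> ee (of_real \<psi>) * (a * ee z) = b * ee (z * of_real \<alpha>)"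
    by (simp add: B_matrix_def vec_eq_iff forall_2 matrix_vector_mult_def sum_2 del: of_real_diff)
  also have "ee (of_real \<psi>) * (a * ee z) = b * ee (z * of_real \<alpha>) \<longleftrightarrow>
      b = a * ee (of_real \<psi> + z * of_real (1 - \<alpha>))"
  proof -
    have "ee (of_real \<psi>) * (a * ee z) = (a * ee (of_real \<psi> + z * of_real (1 - \<alpha>))) * ee (z * of_real \<alpha>)"
      by (simp add: algebra_simps flip: ee_add)
    then show ?thesis by (simp only: mult_cancel_right ee_nonzero) auto
  qed
  also have "- (ee (of_real (\<theta> - \<psi>)) * (b * ee (z * of_real \<beta>))) = a \<and>
      b = a * ee (of_real \<psi> + z * of_real (1 - \<alpha>)) \<longleftrightarrow> b = a * ee (of_real \<psi> + z * of_real (1 - \<alpha>))"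
  proof -
    have "ee (of_real (\<theta> - \<psi>)) * ((a * ee (of_real \<psi> + z * of_real (1 - \<alpha>))) * ee (z * of_real \<beta>))
        = a * ee (of_real \<theta> + z * of_real (1 + \<beta> - \<alpha>))"
      by (simp add: algebra_simps flip: ee_add)
    also have "\<dots> = - a" by (simp only: spec) simp
    finally show ?thesis by auto
  qed
  finally show ?thesis
    unfolding PB_eigenfunction_plane_wave_iff[OF \<alpha>] by auto
qed

lemma PB_spectral_w_zero_iff:
  assumes \<alpha>: "1 < \<alpha>" "\<alpha> < \<beta>"
  shows "PB_spectral \<alpha> \<beta> (B_matrix 0 \<phi> \<psi> \<theta>) \<longleftrightarrow>
    (\<forall>z\<in>PB_spectrum \<alpha> \<beta> (B_matrix 0 \<phi> \<psi> \<theta>). ee (of_real \<psi> + z * of_real (1 - \<alpha>)) = 1)"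
  unfolding PB_spectral_def
proof (rule ball_cong[OF refl])
  fix z assume z: "z \<in> PB_spectrum \<alpha> \<beta> (B_matrix 0 \<phi> \<psi> \<theta>)"
  define q where "q = ee (of_real \<psi> + z * of_real (1 - \<alpha>))"
  have "(\<forall>a b. a \<noteq> 0 \<and> b = a * q \<longrightarrow> a = b) \<longleftrightarrow> q = 1"
  proof
    assume "\<forall>a b. a \<noteq> 0 \<and> b = a * q \<longrightarrow> a = b"
    from this[rule_format, of 1 q] show "q = 1" by simp
  qed simp
  then show "(\<forall>a b. PB_eigenfunction \<alpha> \<beta> (B_matrix 0 \<phi> \<psi> \<theta>) z
       (\<lambda>x. (a * indicator {0..1} x + b * indicator {\<alpha>..\<beta>} x) * ee (z * of_real x)) \<longrightarrow> a = b)
      \<longleftrightarrow> ee (of_real \<psi> + z * of_real (1 - \<alpha>)) = 1"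
    unfolding PB_eigenfunction_w_zero_iff[OF \<alpha> z] q_def .
qed

lemma all_integer_shifts_iff:
  fixes p d :: real
  shows "(\<forall>n::int. p + of_int n * d \<in> \<int>) \<longleftrightarrow> p \<in> \<int> \<and> d \<in> \<int>"
proof
  assume all: "\<forall>n::int. p + of_int n * d \<in> \<int>"
  from all[rule_format, of 0] have p: "p \<in> \<int>" by simp
  from all[rule_format, of 1] have "p + d \<in> \<int>" by simp
  from Ints_diff[OF this p] p show "p \<in> \<int> \<and> d \<in> \<int>" by simp
qed (simp add: Ints_add Ints_mult)

lemma Nats_iff_Ints_nonneg: "0 \<le> x \<Longrightarrow> x \<in> \<nat> \<longleftrightarrow> x \<in> \<int>" for x :: real
  by (simp add: Nats_altdef2)

theorem theorem5p3:
  fixes \<alpha> \<beta> w \<phi> \<psi> \<theta> :: real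
  assumes "1 < \<alpha>" and "\<alpha> < \<beta>" and "w = 0"
  shows "(PB_spectral \<alpha> \<beta> (B_matrix w \<phi> \<psi> \<theta>) \<longleftrightarrow>
            \<beta> / (1 + \<beta> - \<alpha>) \<in> \<nat> \<and>
            - \<psi> + (\<theta> - 1/2) * (1 - \<alpha>) / (1 + \<beta> - \<alpha>) \<in> \<int>) \<and>
         (PB_spectral \<alpha> \<beta> (B_matrix w \<phi> \<psi> \<theta>) \<longrightarrow>
            PB_spectrum \<alpha> \<beta> (B_matrix w \<phi> \<psi> \<theta>) =
              {complex_of_real ((1/2 - \<theta>) / (1 + \<beta> - \<alpha>) + 1 / (1 + \<beta> - \<alpha>) * of_int n) | n :: int. True})"
proof -
  define L where "L = 1 + \<beta> - \<alpha>"
  have L: "L > 0" using assms by (simp add: L_def)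
  \<comment> \<open>The exponent at the point \<open>n = 0\<close> of the spectrum; it grows by
    \<open>(1 - \<alpha>) / L\<close> from each point to the next.\<close>
  define p where "p = \<psi> + (1/2 - \<theta>) * (1 - \<alpha>) / L"
  have ee_int: "ee (of_real x) = 1 \<longleftrightarrow> x \<in> \<int>" for x :: real
  proof -
    have "complex_of_real x = of_int n \<longleftrightarrow> x = of_int n" for n
      using of_real_eq_iff[where 'a = complex, of x "of_int n"] unfolding of_real_of_int_eq .
    then show ?thesis unfolding ee_eq_1_iff by (auto elim: Ints_cases)
  qed
  have ball_range: "(\<forall>z\<in>{g n | n. True}. Q z) \<longleftrightarrow> (\<forall>n. Q (g n))" for g :: "int \<Rightarrow> complex" and Q
    by blast
  have "PB_spectral \<alpha> \<beta> (B_matrix 0 \<phi> \<psi> \<theta>) \<longleftrightarrow>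
      (\<forall>n::int. ee (of_real \<psi> + of_real ((1/2 - \<theta>) / L + 1 / L * of_int n) * of_real (1 - \<alpha>)) = 1)"
    unfolding PB_spectral_w_zero_iff[OF assms(1,2)] PB_spectrum_w_zero[OF assms(1,2)] L_def by (rule ball_range)
  also have "\<dots> \<longleftrightarrow> (\<forall>n::int. p + of_int n * ((1 - \<alpha>) / L) \<in> \<int>)"
  proof (intro all_cong1)
    fix n :: int
    have "complex_of_real \<psi> + of_real ((1/2 - \<theta>) / L + 1 / L * of_int n) * of_real (1 - \<alpha>)
        = of_real (\<psi> + ((1/2 - \<theta>) / L + 1 / L * of_int n) * (1 - \<alpha>))"
      by (simp only: of_real_add of_real_mult)
    also have "\<psi> + ((1/2 - \<theta>) / L + 1 / L * of_int n) * (1 - \<alpha>) = p + of_int n * ((1 - \<alpha>) / L)"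
      by (simp add: p_def distrib_right)
    finally show "ee (of_real \<psi> + of_real ((1/2 - \<theta>) / L + 1 / L * of_int n) * of_real (1 - \<alpha>)) = 1 \<longleftrightarrow>
        p + of_int n * ((1 - \<alpha>) / L) \<in> \<int>"
      by (simp only: ee_int)
  qed
  also have "\<dots> \<longleftrightarrow> p \<in> \<int> \<and> (1 - \<alpha>) / L \<in> \<int>" by (rule all_integer_shifts_iff)
  also have "p \<in> \<int> \<longleftrightarrow> - \<psi> + (\<theta> - 1/2) * (1 - \<alpha>) / L \<in> \<int>"
  proof -
    have "- \<psi> + (\<theta> - 1/2) * (1 - \<alpha>) / L = - p"
      using L by (simp add: p_def field_simps)
    then show ?thesis by (simp only: minus_in_Ints_iff)
  qed
  also have "(1 - \<alpha>) / L \<in> \<int> \<longleftrightarrow> \<beta> / L \<in> \<nat>"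
  proof -
    have "(1 - \<alpha>) / L + \<beta> / L = 1"
      using L unfolding add_divide_distrib[symmetric] by (simp add: L_def)
    then have eq: "(1 - \<alpha>) / L = 1 - \<beta> / L" "\<beta> / L = 1 - (1 - \<alpha>) / L" by linarith+
    have "(1 - \<alpha>) / L \<in> \<int> \<longleftrightarrow> \<beta> / L \<in> \<int>"
      using Ints_diff[OF Ints_1, of "\<beta> / L"] Ints_diff[OF Ints_1, of "(1 - \<alpha>) / L"]
      unfolding eq(1)[symmetric] eq(2)[symmetric] by blast
    then show ?thesis using Nats_iff_Ints_nonneg[of "\<beta> / L"] assms L by simp
  qed
  finally have spectral: "PB_spectral \<alpha> \<beta> (B_matrix 0 \<phi> \<psi> \<theta>) \<longleftrightarrow>
      - \<psi> + (\<theta> - 1/2) * (1 - \<alpha>) / L \<in> \<int> \<and> \<beta> / L \<in> \<nat>" .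
  show ?thesis
    unfolding \<open>w = 0\<close> L_def[symmetric]
  proof (intro conjI impI)
    show "PB_spectral \<alpha> \<beta> (B_matrix 0 \<phi> \<psi> \<theta>) \<longleftrightarrow>
        \<beta> / L \<in> \<nat> \<and> - \<psi> + (\<theta> - 1/2) * (1 - \<alpha>) / L \<in> \<int>"
      using spectral by (rule trans[OF _ conj_commute])
    show "PB_spectrum \<alpha> \<beta> (B_matrix 0 \<phi> \<psi> \<theta>) =
        {complex_of_real ((1/2 - \<theta>) / L + 1 / L * of_int n) | n :: int. True}"
      unfolding L_def by (rule PB_spectrum_w_zero[OF assms(1,2)])
  qed
qed

end
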